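(* Let $\{\mathbf{W}_j\}_{j\in T_2}\subset \ell^2(\Lambda,\mathbb{C}^S)$ be such that $\mathcal{G}(\Lambda,T_1,T_2,\mathbf{W}_j)$ is a DVNUG Bessel sequence with Bessel bound $B_0$ for $\ell^2(\Lambda,\mathbb{C}^S)$. Then for all $m\in T_1$, $j\in T_2$ and a.e. $\xi\in\Omega$, $$\big\|\mathcal{F}(E_{\frac{m}{M}}\mathbf{W}_j)(\xi)\big\|_{\mathbb{C}^S}\le 2\sqrt{NB_0}.$$
   Context: Standing setting: $N,M,S\in\mathbb{N}$ (positive integers), $P\in\mathbb{N}\cup\{0\}$, $r$ is an odd integer coprime with $N$ with $1\le r\le 2N-1$, $\Lambda=\{0,\frac{r}{N}\}+2\mathbb{Z}$, $\Omega=[0,\frac12)\cup[\frac N2,\frac{N+1}{2})$, $T_1=\{0,1,\dots,M-1\}$, $T_2=\{0,1,\dots,P\}$. For $\mathbf{X}\in\mathbb{C}^S$, $[\mathbf{X}]_k$ is its $k$-th coordinate and $\|\mathbf{X}\|_{\mathbb{C}^S}=(\sum_{k=1}^S|[\mathbf{X}]_k|^2)^{1/2}$. $\ell^2(\Lambda,\mathbb{C}^S)$ is the Hilbert space of families $\mathbf{Z}=\{\mathbf{Z}(\lambda)\}_{\lambda\in\Lambda}\subset\mathbb{C}^S$ with $\sum_{\lambda\in\Lambda}\sum_{k=1}^S|[\mathbf{Z}(\lambda)]_k|^2<\infty$, with inner product $\langle\mathbf{Z},\mathbf{W}\rangle=\sum_{\lambda\in\Lambda}\sum_{k=1}^S[\mathbf{Z}(\lambda)]_k\overline{[\mathbf{W}(\lambda)]_k}$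 and induced norm $\|\cdot\|_{\ell^2}$. Operators on $\ell^2(\Lambda,\mathbb{C}^S)$: for $\lambda\in\Lambda$, $(R_{2N\lambda}\mathbf{Z})(\lambda')=\mathbf{Z}(\lambda'-2N\lambda)$, $\lambda'\in\Lambda$ (well defined since $2N\Lambda\subset 2\mathbb{Z}$); for $m\in T_1$, $(E_{\frac mM}\mathbf{Z})(\lambda')=e^{2\pi i\frac mM\lambda'}\mathbf{Z}(\lambda')$, $\lambda'\in\Lambda$. Fourier transform: $\mathcal{F}:\ell^2(\Lambda,\mathbb{C}^S)\to L^2(\Omega,\mathbb{C}^S)$, $[\mathcal{F}(\mathbf{Z})(\xi)]_k=\sum_{\lambda\in\Lambda}[\mathbf{Z}(\lambda)]_k e^{2\pi i\lambda\xi}$, $1\le k\le S$ (series convergent in $L^2(\Omega)$). $\mathcal{G}(\Lambda,T_1,T_2,\mathbf{W}_j)$ denotes the collection $\{E_{\frac mM}R_{2N\lambda}\mathbf{W}_j:\lambda\in\Lambda,\,m\in T_1,\,j\in T_2\}$ (the discrete vector-valued nonuniform Gabor system, DVNUG system, with window sequences $\mathbf{W}_j$). It is a DVNUG Bessel sequence with Bessel bound $\beta$ ($0<\beta<\infty$) if $\sum_{m\in T_1,\,j\in T_2,\,\lambda\in\Lambda}|\langle\mathbf{Z},E_{\frac mM}R_{2N\lambda}\mathbf{W}_j\rangle|^2\le\beta\|\mathbf{Z}\|_{\ell^2}^2$ for all $\mathbf{Z}\in\ell^2(\Lambda,\mathbb{C}^S)$. *)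

theory Defs
  imports "HOL-Analysis.Analysis"
begin

text \<open>
  The space of S-dimensional complex vectors is \<open>complex ^ 's\<close> with \<open>S = CARD('s)\<close>;
  its library norm is the Euclidean norm.  A family indexed by the spectrum \<open>Lam N r\<close> is an
  extensional function on \<open>Lam N r \<subseteq> \<real>\<close>.
\<close>

definition Lam :: "nat \<Rightarrow> nat \<Rightarrow> real set" where
  "Lam N r = {a + 2 * of_int k | a k. a \<in> {0, real r / real N}}"

definition Omega :: "nat \<Rightarrow> real set" where
  "Omega N = {0..<1/2} \<union> {real N / 2..<(real N + 1) / 2}"

definition T1 :: "nat \<Rightarrow> nat set" where
  "T1 M = {0..<M}"

definition T2 :: "nat \<Rightarrow> nat set" where
  "T2 P = {0..P}"

definition ell2 :: "nat \<Rightarrow> nat \<Rightarrow> (real \<Rightarrow> complex ^ 's) set" where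
  "ell2 N r = {Z \<in> extensional (Lam N r).
     (\<lambda>l. \<Sum>k\<in>UNIV. (cmod (Z l $ k))\<^sup>2) summable_on Lam N r}"

definition ell2_inner ::
    "nat \<Rightarrow> nat \<Rightarrow> (real \<Rightarrow> complex ^ 's) \<Rightarrow> (real \<Rightarrow> complex ^ 's) \<Rightarrow> complex" where
  "ell2_inner N r Z W = (\<Sum>\<^sub>\<infinity>l\<in>Lam N r. \<Sum>k\<in>UNIV. Z l $ k * cnj (W l $ k))"

definition ell2_norm :: "nat \<Rightarrow> nat \<Rightarrow> (real \<Rightarrow> complex ^ 's) \<Rightarrow> real" where
  "ell2_norm N r Z = sqrt (Re (ell2_inner N r Z Z))"

text \<open>\<open>Rshift N r l\<close> is translation by \<open>2 * N * l\<close>, and \<open>Emod N r a\<close> is modulation by \<open>a\<close>.\<close>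

definition Rshift ::
    "nat \<Rightarrow> nat \<Rightarrow> real \<Rightarrow> (real \<Rightarrow> complex ^ 's) \<Rightarrow> real \<Rightarrow> complex ^ 's" where
  "Rshift N r l Z = (\<lambda>l'\<in>Lam N r. Z (l' - 2 * real N * l))"

definition Emod ::
    "nat \<Rightarrow> nat \<Rightarrow> real \<Rightarrow> (real \<Rightarrow> complex ^ 's) \<Rightarrow> real \<Rightarrow> complex ^ 's" where
  "Emod N r a Z = (\<lambda>l'\<in>Lam N r. cis (2 * pi * a * l') *s Z l')"

definition L2_Omega :: "nat \<Rightarrow> (real \<Rightarrow> complex ^ 's) set" where
  "L2_Omega N = {f \<in> borel_measurable (lebesgue_on (Omega N)).
     integrable (lebesgue_on (Omega N)) (\<lambda>\<xi>. (norm (f \<xi>))\<^sup>2)}"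

text \<open>
  \<open>f\<close> represents the Fourier transform of \<open>Z\<close>: each coordinate of \<open>f\<close> is the (unconditional)
  sum of the corresponding exponential series in the square-integrable functions on \<open>Omega N\<close>.
\<close>

definition is_fourier ::
    "nat \<Rightarrow> nat \<Rightarrow> (real \<Rightarrow> complex ^ 's) \<Rightarrow> (real \<Rightarrow> complex ^ 's) \<Rightarrow> bool" where
  "is_fourier N r Z f \<longleftrightarrow> f \<in> L2_Omega N \<and>
     (\<forall>k. ((\<lambda>A. LINT \<xi>|lebesgue_on (Omega N).
              (cmod (f \<xi> $ k - (\<Sum>l\<in>A. Z l $ k * cis (2 * pi * l * \<xi>))))\<^sup>2)
            \<longlongrightarrow> 0) (finite_subsets_at_top (Lam N r)))"

text \<open>
  The transform is determined only up to null sets, so a representative is chosen.  Any two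
  functions satisfying \<open>is_fourier N r Z\<close> agree almost everywhere on \<open>Omega N\<close>.
\<close>

definition fourier ::
    "nat \<Rightarrow> nat \<Rightarrow> (real \<Rightarrow> complex ^ 's) \<Rightarrow> real \<Rightarrow> complex ^ 's" where
  "fourier N r Z = (SOME f. is_fourier N r Z f)"

definition dvnug ::
    "nat \<Rightarrow> nat \<Rightarrow> nat \<Rightarrow> (nat \<Rightarrow> real \<Rightarrow> complex ^ 's) \<Rightarrow> nat \<times> nat \<times> real \<Rightarrow> real \<Rightarrow> complex ^ 's"
where
  "dvnug N r M W = (\<lambda>(m, j, l). Emod N r (real m / real M) (Rshift N r l (W j)))"

text \<open>Summability is required explicitly because a divergent \<open>infsum\<close> has the value 0.\<close>

definition dvnug_bessel ::
    "nat \<Rightarrow> nat \<Rightarrow> nat \<Rightarrow> nat \<Rightarrow> (nat \<Rightarrow> real \<Rightarrow> complex ^ 's) \<Rightarrow> real \<Rightarrow> bool" where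
  "dvnug_bessel N r M P W \<beta> \<longleftrightarrow> 0 < \<beta> \<and>
     (\<forall>Z\<in>ell2 N r.
        (\<lambda>i. (cmod (ell2_inner N r Z (dvnug N r M W i)))\<^sup>2) summable_on (T1 M \<times> T2 P \<times> Lam N r) \<and>
        (\<Sum>\<^sub>\<infinity>i\<in>T1 M \<times> T2 P \<times> Lam N r. (cmod (ell2_inner N r Z (dvnug N r M W i)))\<^sup>2)
          \<le> \<beta> * (ell2_norm N r Z)\<^sup>2)"

end

theory Submission
  imports Defs
begin

text \<open>
  Let \<open>u\<close> be the modulated window and \<open>f\<close> its transform.  Translation by \<open>4 * N * k\<close> of \<open>u\<close>
  becomes multiplication of \<open>f\<close> by \<open>cis (8 * pi * N * k * \<xi>)\<close>, so a combination of such translates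
  has transform \<open>p f\<close> with \<open>p\<close> a trigonometric polynomial of period \<open>1/(4 * N)\<close>.  By duality the
  Bessel condition bounds the energy of the combination by \<open>B\<^sub>0\<close> times the energy of its
  coefficients; that is, the integral of \<open>|p|\<^sup>2 |f|\<^sup>2\<close> over \<open>\<Omega>\<close> is at most \<open>4 * N * B\<^sub>0\<close> times the
  integral of \<open>|p|\<^sup>2\<close> over one period.  Letting \<open>|p|\<close> tend to the indicator of a compact set inside
  a period (Stone--Weierstrass on the circle) gives \<open>|f|\<^sup>2 \<le> 4 * N * B\<^sub>0\<close> almost everywhere.  Only
  the translates by even elements of \<open>2 * N * \<Lambda>\<close> are used, and only the orthonormality, not the
  completeness, of the exponentials on \<open>\<Omega>\<close>.
\<close>

section \<open>Square-integrable functions\<close>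

lemma norm_add_squared_le:
  fixes a b :: "'a :: real_normed_vector"
  shows "(norm (a + b))\<^sup>2 \<le> 2 * (norm a)\<^sup>2 + 2 * (norm b)\<^sup>2"
proof -
  have "(norm (a + b))\<^sup>2 \<le> (norm a + norm b)\<^sup>2"
    by (simp add: norm_triangle_ineq power_mono)
  also have "\<dots> \<le> 2 * (norm a)\<^sup>2 + 2 * (norm b)\<^sup>2"
    using zero_le_power2[of "norm a - norm b"] by (simp add: power2_eq_square algebra_simps)
  finally show ?thesis .
qed

text \<open>Functions are kept as concrete representatives and vectors are treated coordinate by
  coordinate; \<open>is_fourier_iff_fourier_limit\<close> relates this to
  \<open>L2_Omega\<close>.\<close>

definition square_integrable :: "'a measure \<Rightarrow> ('a \<Rightarrow> complex) \<Rightarrow> bool" where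
  "square_integrable M f \<longleftrightarrow>
     f \<in> borel_measurable M \<and> integrable M (\<lambda>x. (cmod (f x))\<^sup>2)"

lemma square_integrableD:
  assumes "square_integrable M f"
  shows "f \<in> borel_measurable M" "integrable M (\<lambda>x. (cmod (f x))\<^sup>2)"
  using assms by (auto simp: square_integrable_def)

lemma square_integrable_mult_bounded:
  assumes f: "square_integrable M f" and g[measurable]: "g \<in> borel_measurable M"
    and B: "\<And>x. cmod (g x) \<le> B"
  shows "square_integrable M (\<lambda>x. g x * f x)"
proof -
  note [measurable] = square_integrableD(1)[OF f]
  have "integrable M (\<lambda>x. (cmod (g x * f x))\<^sup>2)"
  proof (rule Bochner_Integration.integrable_bound)
    show "integrable M (\<lambda>x. B\<^sup>2 * (cmod (f x))\<^sup>2)"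
      using square_integrableD(2)[OF f] by simp
    have "(cmod (g x))\<^sup>2 \<le> B\<^sup>2" for x
      using B[of x] by (simp add: power_mono)
    then show "AE x in M. norm ((cmod (g x * f x))\<^sup>2) \<le> norm (B\<^sup>2 * (cmod (f x))\<^sup>2)"
      by (auto simp: norm_mult power_mult_distrib intro!: mult_right_mono)
  qed measurable
  then show ?thesis
    by (simp add: square_integrable_def)
qed

lemma square_integrable_add:
  assumes f: "square_integrable M f" and g: "square_integrable M g"
  shows "square_integrable M (\<lambda>x. f x + g x)"
proof -
  note [measurable] = square_integrableD(1)[OF f] square_integrableD(1)[OF g]
  have "integrable M (\<lambda>x. (cmod (f x + g x))\<^sup>2)"
  proof (rule Bochner_Integration.integrable_bound)
    show "integrable M (\<lambda>x. 2 * (cmod (f x))\<^sup>2 + 2 * (cmod (g x))\<^sup>2)"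
      using square_integrableD(2)[OF f] square_integrableD(2)[OF g] by simp
  qed (use norm_add_squared_le in auto)
  then show ?thesis
    by (simp add: square_integrable_def)
qed

lemma square_integrable_cmult:
  "square_integrable M f \<Longrightarrow> square_integrable M (\<lambda>x. c * f x)"
  by (auto intro: square_integrable_mult_bounded[where B = "cmod c"])

lemma square_integrable_diff:
  assumes "square_integrable M f" "square_integrable M g"
  shows "square_integrable M (\<lambda>x. f x - g x)"
  using square_integrable_add[OF assms(1) square_integrable_cmult[OF assms(2), of "-1"]] by simp

lemma integral_norm_add_squared_le:
  assumes f: "square_integrable M f" and g: "square_integrable M g"
  shows "(LINT x|M. (cmod (f x + g x))\<^sup>2)
           \<le> 2 * (LINT x|M. (cmod (f x))\<^sup>2) + 2 * (LINT x|M. (cmod (g x))\<^sup>2)"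
proof -
  have "(LINT x|M. (cmod (f x + g x))\<^sup>2) \<le> (LINT x|M. 2 * (cmod (f x))\<^sup>2 + 2 * (cmod (g x))\<^sup>2)"
    using square_integrableD(2)[OF f] square_integrableD(2)[OF g]
      square_integrableD(2)[OF square_integrable_add[OF f g]] norm_add_squared_le
    by (intro integral_mono) auto
  also have "\<dots> = 2 * (LINT x|M. (cmod (f x))\<^sup>2) + 2 * (LINT x|M. (cmod (g x))\<^sup>2)"
    using square_integrableD(2)[OF f] square_integrableD(2)[OF g] by simp
  finally show ?thesis .
qed

text \<open>Riesz--Fischer for a rapidly Cauchy sequence. The squared increments stay summable in
  the mean after weighting, which gives convergence almost everywhere; Fatou's lemma then carries
  the error bound over to the limit.\<close>

lemma square_integrable_limit:
  fixes F :: "nat \<Rightarrow> 'a \<Rightarrow> complex"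
  assumes sq: "\<And>n. square_integrable M (F n)"
    and cauchy: "\<And>m n. n \<le> m \<Longrightarrow> (LINT x|M. (cmod (F m x - F n x))\<^sup>2) \<le> (1/4) ^ n"
  obtains f where "square_integrable M f"
    and "\<And>n. (LINT x|M. (cmod (f x - F n x))\<^sup>2) \<le> (1/4) ^ n"
proof -
  note [measurable] = square_integrableD(1)[OF sq]
  define f where "f = (\<lambda>x. lim (\<lambda>n. F n x))"
  have [measurable]: "f \<in> borel_measurable M"
    unfolding f_def by measurable
  have sqd: "integrable M (\<lambda>x. (cmod (F m x - F n x))\<^sup>2)" for m n
    using square_integrableD(2)[OF square_integrable_diff[OF sq sq]] by simp
  have nn: "(\<integral>\<^sup>+x. ennreal ((cmod (F m x - F n x))\<^sup>2) \<partial>M) \<le> ennreal ((1/4) ^ n)"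
    if "n \<le> m" for m n
    using cauchy[OF that] sqd[of m n] by (subst nn_integral_eq_integral) auto
  \<comment> \<open>The weight \<open>2 ^ n\<close> is a compromise: the integral of
    \<open>d n\<close> is at most \<open>(1/2) ^ n\<close>, while \<open>(1/2) ^ n + d n x\<close>
    still dominates the modulus of the increment.\<close>
  define d where "d n x = 2 ^ n * (cmod (F (Suc n) x - F n x))\<^sup>2" for n x
  have "(\<integral>\<^sup>+x. (\<Sum>n. ennreal (d n x)) \<partial>M) = (\<Sum>n. \<integral>\<^sup>+x. ennreal (d n x) \<partial>M)"
    unfolding d_def by (rule nn_integral_suminf) measurable
  also have "\<dots> \<le> (\<Sum>n. ennreal ((1/2) ^ n))"
  proof (intro suminf_le allI)
    fix n
    have "(\<integral>\<^sup>+x. ennreal (d n x) \<partial>M)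
        = ennreal (2 ^ n) * (\<integral>\<^sup>+x. ennreal ((cmod (F (Suc n) x - F n x))\<^sup>2) \<partial>M)"
      unfolding d_def by (simp add: ennreal_mult nn_integral_cmult)
    also have "\<dots> \<le> ennreal (2 ^ n) * ennreal ((1/4) ^ n)"
      using nn[of n "Suc n"] by (intro mult_left_mono) auto
    also have "\<dots> = ennreal ((1/2) ^ n)"
      by (simp add: ennreal_mult[symmetric] power_mult_distrib[symmetric])
    finally show "(\<integral>\<^sup>+x. ennreal (d n x) \<partial>M) \<le> ennreal ((1/2) ^ n)" .
  qed auto
  also have "\<dots> = ennreal (\<Sum>n. (1/2) ^ n)"
    by (rule suminf_ennreal2) (auto intro: summable_geometric)
  finally have "(\<integral>\<^sup>+x. (\<Sum>n. ennreal (d n x)) \<partial>M) \<noteq> \<infinity>"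
    by (auto simp: top_unique)
  then have "AE x in M. (\<Sum>n. ennreal (d n x)) \<noteq> \<infinity>"
    by (intro nn_integral_PInf_AE) (auto simp: d_def)
  then have lim: "AE x in M. (\<lambda>n. F n x) \<longlonglongrightarrow> f x"
  proof eventually_elim
    fix x assume "(\<Sum>n. ennreal (d n x)) \<noteq> \<infinity>"
    then have "summable (\<lambda>n. d n x)"
      by (intro summable_suminf_not_top) (auto simp: d_def)
    then have "summable (\<lambda>n. (1/2) ^ n + d n x)"
      by (intro summable_add summable_geometric) auto
    moreover have "norm (F (Suc n) x - F n x) \<le> (1/2) ^ n + d n x" for n
    proof -
      let ?a = "cmod (F (Suc n) x - F n x)"
      \<comment> \<open>Expanding this square bounds \<open>2 * ?a\<close> by
        \<open>(1/2) ^ n + d n x\<close>.\<close>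
      have "0 \<le> (1/2) ^ n * (1 - 2 ^ n * ?a)\<^sup>2"
        by simp
      also have "\<dots> = (1/2) ^ n + ((1/2) ^ n * 2 ^ n) * 2 ^ n * ?a\<^sup>2 - 2 * ((1/2) ^ n * 2 ^ n) * ?a"
        by (simp only: power2_eq_square) (simp add: algebra_simps)
      also have "(1/2) ^ n * 2 ^ n = (1::real)"
        by (simp add: power_mult_distrib[symmetric])
      finally show ?thesis
        unfolding d_def using norm_ge_zero[of "F (Suc n) x - F n x"] by linarith
    qed
    ultimately have "summable (\<lambda>n. F (Suc n) x - F n x)"
      by (rule summable_comparison_test'[where N = 0]) 
    then have "convergent (\<lambda>n. F n x)"
      by (simp add: summable_iff_convergent sum_lessThan_telescope[of "\<lambda>n. F n x"]
          convergent_diff_const_right_iff)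
    then show "(\<lambda>n. F n x) \<longlonglongrightarrow> f x"
      by (simp add: f_def convergent_LIMSEQ_iff)
  qed
  have le: "(\<integral>\<^sup>+x. ennreal ((cmod (f x - F n x))\<^sup>2) \<partial>M) \<le> ennreal ((1/4) ^ n)" for n
  proof -
    have "(\<integral>\<^sup>+x. ennreal ((cmod (f x - F n x))\<^sup>2) \<partial>M)
        = (\<integral>\<^sup>+x. liminf (\<lambda>m. ennreal ((cmod (F m x - F n x))\<^sup>2)) \<partial>M)"
    proof (rule nn_integral_cong_AE, use lim in eventually_elim)
      fix x assume "(\<lambda>n. F n x) \<longlonglongrightarrow> f x"
      then have "(\<lambda>m. ennreal ((cmod (F m x - F n x))\<^sup>2)) \<longlonglongrightarrow> ennreal ((cmod (f x - F n x))\<^sup>2)"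
        by (intro tendsto_ennrealI tendsto_intros)
      then show "ennreal ((cmod (f x - F n x))\<^sup>2) = liminf (\<lambda>m. ennreal ((cmod (F m x - F n x))\<^sup>2))"
        by (rule lim_imp_Liminf[symmetric, OF sequentially_bot])
    qed
    also have "\<dots> \<le> liminf (\<lambda>m. \<integral>\<^sup>+x. ennreal ((cmod (F m x - F n x))\<^sup>2) \<partial>M)"
      by (rule nn_integral_liminf) measurable
    also have "\<dots> \<le> ennreal ((1/4) ^ n)"
      by (rule Liminf_le) (auto intro!: eventually_sequentiallyI[of n] nn)
    finally show ?thesis .
  qed
  have int: "integrable M (\<lambda>x. (cmod (f x - F n x))\<^sup>2)" for n
    using le[of n] by (intro integrableI_bounded) (auto simp: le_less_trans)
  show ?thesis
  proof
    have "square_integrable M (\<lambda>x. (f x - F 0 x) + F 0 x)"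
      by (intro square_integrable_add sq) (auto simp: square_integrable_def int)
    then show "square_integrable M f" by simp
    show "(LINT x|M. (cmod (f x - F n x))\<^sup>2) \<le> (1/4) ^ n" for n
      using le[of n] int[of n] by (subst (asm) nn_integral_eq_integral) auto
  qed
qed

text \<open>Expanding the square leaves only the diagonal terms. It is applied on \<Omega> with
  frequencies from the spectrum and \<open>c = 1\<close>, and on a period of length
  \<open>1/t\<close> with frequencies \<open>t * i\<close> and \<open>c = 1/t\<close>.\<close>

lemma integral_norm_sum_cis_squared:
  fixes \<omega> :: "'i \<Rightarrow> real"
  assumes "finite_measure M" and "id \<in> borel_measurable M" and "finite A"
    and orth: "\<And>i j. i \<in> A \<Longrightarrow> j \<in> A \<Longrightarrow>
      (LINT x|M. cis (2 * pi * (\<omega> i - \<omega> j) * x)) = (if i = j then of_real c else 0)"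
  shows "(LINT x|M. (cmod (\<Sum>i\<in>A. z i * cis (2 * pi * \<omega> i * x)))\<^sup>2) = c * (\<Sum>i\<in>A. (cmod (z i))\<^sup>2)"
proof -
  interpret finite_measure M by fact
  have [measurable]: "(\<lambda>x. x) \<in> borel_measurable M"
    using assms(2) by (simp add: id_def)
  have int: "integrable M (\<lambda>x. cis (t * x))" for t
    by (rule integrable_const_bound[where B = 1]) (auto simp: cis_conv_exp)
  have sq: "of_real ((cmod (\<Sum>i\<in>A. z i * cis (2 * pi * \<omega> i * x)))\<^sup>2)
      = (\<Sum>i\<in>A. \<Sum>j\<in>A. (z i * cnj (z j)) * cis (2 * pi * (\<omega> i - \<omega> j) * x))" for x
  proof -
    have "cis (2 * pi * \<omega> i * x) * cnj (cis (2 * pi * \<omega> j * x)) = cis (2 * pi * (\<omega> i - \<omega> j) * x)" for i j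
      by (simp add: cis_cnj cis_mult algebra_simps)
    then show ?thesis
      unfolding complex_norm_square by (simp add: sum_product mult_ac)
  qed
  have "complex_of_real (LINT x|M. (cmod (\<Sum>i\<in>A. z i * cis (2 * pi * \<omega> i * x)))\<^sup>2)
      = (LINT x|M. (\<Sum>i\<in>A. \<Sum>j\<in>A. (z i * cnj (z j)) * cis (2 * pi * (\<omega> i - \<omega> j) * x)))"
    unfolding sq[symmetric] by (simp del: of_real_power)
  also have "\<dots> = (\<Sum>i\<in>A. \<Sum>j\<in>A. (z i * cnj (z j)) * (LINT x|M. cis (2 * pi * (\<omega> i - \<omega> j) * x)))"
    using int by simp
  also have "\<dots> = (\<Sum>i\<in>A. \<Sum>j\<in>A. if i = j then (z i * cnj (z i)) * of_real c else 0)"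
    by (intro sum.cong refl) (auto simp: orth)
  also have "\<dots> = of_real (c * (\<Sum>i\<in>A. (cmod (z i))\<^sup>2))"
    using \<open>finite A\<close> by (simp add: complex_norm_square[symmetric] sum_distrib_left mult.commute del: of_real_power)
  finally show ?thesis by (simp only: of_real_eq_iff)
qed

section \<open>The Fourier transform on the spectrum\<close>

lemma integral_cis:
  fixes d a b :: real
  assumes "d \<noteq> 0" "a \<le> b"
  shows "((\<lambda>x. cis (2 * pi * d * x)) has_integral
           (cis (2 * pi * d * b) - cis (2 * pi * d * a)) / (2 * pi * \<i> * d)) {a..b}"
proof -
  let ?g = "\<lambda>x. cis (2 * pi * d * x) / (2 * pi * \<i> * d)"
  have "((\<lambda>x. cis (2 * pi * d * x)) has_integral (?g b - ?g a)) {a..b}"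
  proof (rule fundamental_theorem_of_calculus[OF assms(2)])
    fix x
    show "(?g has_vector_derivative cis (2 * pi * d * x)) (at x within {a..b})"
      using assms(1) unfolding cis_conv_exp
      by (auto intro!: derivative_eq_intros has_vector_derivative_real_field simp: field_simps)
  qed
  then show ?thesis
    by (simp add: diff_divide_distrib)
qed

lemma integral_lebesgue_on_cis:
  assumes "S \<in> lmeasurable" and "((\<lambda>x. cis (2 * pi * d * x)) has_integral I) S"
  shows "(LINT x|lebesgue_on S. cis (2 * pi * d * x)) = I"
proof -
  interpret finite_measure "lebesgue_on S"
    using assms(1) by (rule finite_measure_lebesgue_on)
  have [measurable]: "(\<lambda>x. x) \<in> borel_measurable (lebesgue_on S)"
    using id_borel_measurable_lebesgue_on[of S] by (simp add: id_def)
  have "integrable (lebesgue_on S) (\<lambda>x. cis (2 * pi * d * x))"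
    by (rule integrable_const_bound[where B = 1]) (auto simp: cis_conv_exp)
  then show ?thesis
    using assms integral_unique by (metis fmeasurableD lebesgue_integral_eq_integral)
qed

lemma Omega_lmeasurable [simp]: "Omega N \<in> lmeasurable"
proof -
  have "Omega N \<in> sets borel" and "Omega N \<subseteq> {0..real N + 1}"
    by (auto simp: Omega_def)
  then show ?thesis
    by (intro bounded_set_imp_lmeasurable) (auto intro: bounded_subset[OF bounded_closed_interval])
qed

lemma finite_measure_Omega: "finite_measure (lebesgue_on (Omega N))"
  by (intro finite_measure_lebesgue_on Omega_lmeasurable)

text \<open>The two cases match the two factors of the integral over \<Omega>: an even difference
  kills one, an odd multiple of \<open>1/N\<close> kills the other. The second case rests on
  \<open>r\<close> being odd.\<close>

lemma Lam_diff_cases: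
  assumes "N \<ge> 1" "odd r" "x \<in> Lam N r" "y \<in> Lam N r"
  obtains n :: int where "x - y = 2 * of_int n"
    | n :: int where "real N * (x - y) = 2 * of_int n + 1"
proof -
  obtain q where q: "int r = 2 * q + 1"
    using \<open>odd r\<close> by (metis oddE even_of_nat_iff)
  then have r: "real r = 2 * of_int q + 1"
    by (metis of_int_add of_int_mult of_int_numeral of_int_1 of_int_of_nat_eq)
  from assms(3,4) obtain a b k l where
    "a \<in> {0, real r / real N}" "b \<in> {0, real r / real N}"
    and x: "x = a + 2 * of_int k" and y: "y = b + 2 * of_int l"
    by (auto simp: Lam_def)
  then consider "a = b" | "a = real r / real N" "b = 0" | "a = 0" "b = real r / real N"
    by auto
  then show thesis
  proof cases
    case 1
    then show ?thesis by (intro that(1)[of "k - l"]) (simp add: x y)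
  next
    case 2
    then show ?thesis
      using assms(1) by (intro that(2)[of "q + int N * (k - l)"]) (simp add: x y r field_simps)
  next
    case 3
    then show ?thesis
      using assms(1) by (intro that(2)[of "int N * (k - l) - q - 1"]) (simp add: x y r field_simps)
  qed
qed

lemma cis_2pi_int [simp]: "cis (2 * pi * of_int n) = 1"
  by (auto simp: complex_eq_iff cos_int_2pin sin_int_2pin)

text \<open>With \<open>d = x - y \<noteq> 0\<close>, the integrals over the two halves of \<Omega>,
  translates of each other by \<open>N/2\<close>, combine to a multiple of
  \<open>(1 + cis (pi * d * N)) * (cis (pi * d) - 1)\<close>, and \<open>Lam_diff_cases\<close>
  makes one factor vanish.\<close>

lemma exponentials_orthonormal_Omega:
  assumes "N \<ge> 1" "odd r" "x \<in> Lam N r" "y \<in> Lam N r"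
  shows "(LINT \<xi>|lebesgue_on (Omega N). cis (2 * pi * (x - y) * \<xi>)) = (if x = y then 1 else 0)"
proof -
  let ?f = "\<lambda>\<xi>. cis (2 * pi * (x - y) * \<xi>)"
  let ?I = "{0..1/2::real}" and ?J = "{real N / 2..(real N + 1) / 2}"
  \<comment> \<open>For \<open>N = 1\<close> the closed intervals meet at \<open>1/2\<close>;
    otherwise they are disjoint.\<close>
  have negl: "negligible (?I \<inter> ?J)"
    by (rule negligible_subset[of "{1/2}"]) (use assms(1) in auto)
  have "(?f has_integral (if x = y then 1 else 0)) (?I \<union> ?J)"
  proof (cases "x = y")
    case True
    have "((\<lambda>_. 1::complex) has_integral (1/2 + 1/2)) (?I \<union> ?J)"
      using has_integral_const_real[of "1::complex" 0 "1/2"]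
        has_integral_const_real[of "1::complex" "real N / 2" "(real N + 1) / 2"]
      by (intro has_integral_Un negl) (auto simp: field_simps scaleR_conv_of_real)
    with True show ?thesis by simp
  next
    case False
    define d where "d = x - y"
    have d: "d \<noteq> 0" using False by (simp add: d_def)
    let ?C = "2 * pi * \<i> * d"
    let ?v = "(cis (2 * pi * d * (1/2)) - cis (2 * pi * d * 0)) / ?C
        + (cis (2 * pi * d * ((real N + 1) / 2)) - cis (2 * pi * d * (real N / 2))) / ?C"
    have *: "((\<lambda>\<xi>. cis (2 * pi * d * \<xi>)) has_integral ?v) (?I \<union> ?J)"
      using d by (intro has_integral_Un negl integral_cis) auto
    have split: "cis (2 * pi * d * ((real N + 1) / 2)) = cis (pi * d * real N) * cis (pi * d)"
      unfolding cis_mult by (rule arg_cong[where f = cis]) (simp add: field_simps)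
    have "?v = (1 + cis (pi * d * real N)) * (cis (pi * d) - 1) / ?C"
      unfolding split add_divide_distrib[symmetric] by (simp add: algebra_simps)
    also have "\<dots> = 0"
      using assms
    proof (cases rule: Lam_diff_cases)
      case (1 n)
      then have "pi * d = 2 * pi * of_int n" by (simp add: d_def)
      then have "cis (pi * d) = 1" by (simp only: cis_2pi_int)
      then show ?thesis by simp
    next
      case (2 n)
      then have "pi * d * real N = 2 * pi * of_int n + pi"
        by (simp add: d_def algebra_simps)
      then have "cis (pi * d * real N) = cis (2 * pi * of_int n) * cis pi"
        by (simp only: cis_mult)
      then show ?thesis by simp
    qed
    finally show ?thesis using * False by (simp add: d_def)
  qed
  moreover have "negligible {t \<in> (?I \<union> ?J) - Omega N. ?f t \<noteq> 0}"
    by (rule negligible_subset[of "{1/2, (real N + 1) / 2}"]) (auto simp: Omega_def)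
  moreover have "negligible {t \<in> Omega N - (?I \<union> ?J). ?f t \<noteq> 0}"
    by (rule negligible_subset[of "{}"]) (auto simp: Omega_def)
  ultimately have "(?f has_integral (if x = y then 1 else 0)) (Omega N)"
    using has_integral_spike_set_eq[of "?I \<union> ?J" "Omega N" ?f] by blast
  then show ?thesis
    by (rule integral_lebesgue_on_cis[OF Omega_lmeasurable])
qed

section \<open>Mean-square limits of exponential sums over the spectrum\<close>

definition fourier_sum :: "(real \<Rightarrow> complex) \<Rightarrow> real set \<Rightarrow> real \<Rightarrow> complex" where
  "fourier_sum z A \<xi> = (\<Sum>l\<in>A. z l * cis (2 * pi * l * \<xi>))"

lemma cis_borel_measurable_Omega [measurable]:
  "(\<lambda>\<xi>. cis (t * \<xi>)) \<in> borel_measurable (lebesgue_on (Omega N))"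
proof -
  have [measurable]: "(\<lambda>x. x) \<in> borel_measurable (lebesgue_on (Omega N))"
    using id_borel_measurable_lebesgue_on[of "Omega N"] by (simp add: id_def)
  show ?thesis unfolding cis_conv_exp by measurable
qed

text \<open>\<open>A\<close> may be infinite: the sum is then 0 by convention and
  \<open>fourier_sum z A\<close> is the zero function.\<close>

lemma square_integrable_fourier_sum: "square_integrable (lebesgue_on (Omega N)) (fourier_sum z A)"
proof (induction A rule: infinite_finite_induct)
  case (insert a A)
  interpret finite_measure "lebesgue_on (Omega N)"
    by (rule finite_measure_Omega)
  have "square_integrable (lebesgue_on (Omega N)) (\<lambda>\<xi>. cis (2 * pi * a * \<xi>) * z a)"
    by (rule square_integrable_mult_bounded[where B = 1]) (auto simp: square_integrable_def)
  moreover have "fourier_sum z (insert a A) = (\<lambda>\<xi>. cis (2 * pi * a * \<xi>) * z a + fourier_sum z A \<xi>)"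
    using insert.hyps by (simp add: fourier_sum_def fun_eq_iff mult.commute)
  ultimately show ?case
    using square_integrable_add[OF _ insert.IH] by metis
qed (auto simp: fourier_sum_def square_integrable_def)

lemma integral_fourier_sum_squared:
  assumes "N \<ge> 1" "odd r" "finite A" "A \<subseteq> Lam N r"
  shows "(LINT \<xi>|lebesgue_on (Omega N). (cmod (fourier_sum z A \<xi>))\<^sup>2) = (\<Sum>l\<in>A. (cmod (z l))\<^sup>2)"
  unfolding fourier_sum_def
proof (subst integral_norm_sum_cis_squared[where \<omega> = "\<lambda>l. l" and c = 1])
  fix i j assume "i \<in> A" "j \<in> A"
  with assms(4) show "(LINT x|lebesgue_on (Omega N). cis (2 * pi * (i - j) * x))
      = (if i = j then complex_of_real 1 else 0)"
    unfolding of_real_1 by (intro exponentials_orthonormal_Omega[OF assms(1,2)]) auto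
qed (use assms(3) finite_measure_Omega in auto)

text \<open>A relation instead of a chosen representative, so that sums, multiples and translates
  can be formed without appeal to uniqueness up to null sets.\<close>

definition fourier_limit ::
    "nat \<Rightarrow> nat \<Rightarrow> (real \<Rightarrow> complex) \<Rightarrow> (real \<Rightarrow> complex) \<Rightarrow> bool" where
  "fourier_limit N r z f \<longleftrightarrow> square_integrable (lebesgue_on (Omega N)) f \<and>
     ((\<lambda>A. LINT \<xi>|lebesgue_on (Omega N). (cmod (f \<xi> - fourier_sum z A \<xi>))\<^sup>2) \<longlongrightarrow> 0)
       (finite_subsets_at_top (Lam N r))"

text \<open>Orthonormality turns tails of the square-summable family into mean-square distances of
  partial sums. Completeness gives a limit along an increasing sequence of finite sets, and the same
  tail estimate extends the convergence to all finite sets.\<close>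

lemma fourier_limit_exists:
  assumes "N \<ge> 1" "odd r" and summ: "(\<lambda>l. (cmod (z l))\<^sup>2) summable_on Lam N r"
  shows "\<exists>f. fourier_limit N r z f"
proof -
  let ?M = "lebesgue_on (Omega N)"
  have "\<exists>C. finite C \<and> C \<subseteq> Lam N r \<and>
      (\<forall>B. finite B \<longrightarrow> B \<subseteq> Lam N r \<longrightarrow> B \<inter> C = {} \<longrightarrow> (\<Sum>l\<in>B. (cmod (z l))\<^sup>2) \<le> (1/4) ^ n)" for n
  proof -
    let ?s = "infsum (\<lambda>l. (cmod (z l))\<^sup>2) (Lam N r)"
    obtain C where C: "finite C" "C \<subseteq> Lam N r" "dist (\<Sum>l\<in>C. (cmod (z l))\<^sup>2) ?s \<le> (1/4) ^ n"
      using infsum_finite_approximation[OF summ, of "(1/4) ^ n"] by auto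
    have "(\<Sum>l\<in>B. (cmod (z l))\<^sup>2) \<le> (1/4) ^ n"
      if B: "finite B" "B \<subseteq> Lam N r" "B \<inter> C = {}" for B
    proof -
      have "(\<Sum>l\<in>B \<union> C. (cmod (z l))\<^sup>2) \<le> ?s"
        using B C summ by (intro finite_sum_le_infsum) auto
      moreover have "(\<Sum>l\<in>B \<union> C. (cmod (z l))\<^sup>2) = (\<Sum>l\<in>B. (cmod (z l))\<^sup>2) + (\<Sum>l\<in>C. (cmod (z l))\<^sup>2)"
        using B C by (intro sum.union_disjoint) auto
      ultimately show ?thesis
        using C(3) by (simp add: dist_real_def)
    qed
    with C show ?thesis by blast
  qed
  then obtain C where C: "\<And>n. finite (C n)" "\<And>n. C n \<subseteq> Lam N r"
    and small: "\<And>n B. finite B \<Longrightarrow> B \<subseteq> Lam N r \<Longrightarrow> B \<inter> C n = {} \<Longrightarrow>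
      (\<Sum>l\<in>B. (cmod (z l))\<^sup>2) \<le> (1/4) ^ n"
    by metis
  define A where "A n = (\<Union>i\<le>n. C i)" for n
  have A: "finite (A n)" "A n \<subseteq> Lam N r" "C n \<subseteq> A n" for n
    using C by (auto simp: A_def)
  have close: "(LINT \<xi>|?M. (cmod (fourier_sum z B \<xi> - fourier_sum z (A n) \<xi>))\<^sup>2) \<le> (1/4) ^ n"
    if B: "finite B" "B \<subseteq> Lam N r" "A n \<subseteq> B" for B n
  proof -
    have "fourier_sum z B \<xi> - fourier_sum z (A n) \<xi> = fourier_sum z (B - A n) \<xi>" for \<xi>
      using B A by (simp add: fourier_sum_def sum_diff)
    then have "(LINT \<xi>|?M. (cmod (fourier_sum z B \<xi> - fourier_sum z (A n) \<xi>))\<^sup>2)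
        = (\<Sum>l\<in>B - A n. (cmod (z l))\<^sup>2)"
      using B A by (simp only:) (rule integral_fourier_sum_squared[OF assms(1,2)], auto)
    also have "\<dots> \<le> (1/4) ^ n"
      using B A(3)[of n] by (intro small) auto
    finally show ?thesis .
  qed
  have "A n \<subseteq> A m" if "n \<le> m" for m n
    using that unfolding A_def by (intro UN_mono) auto
  then obtain f where f: "square_integrable ?M f"
    and lim: "\<And>n. (LINT \<xi>|?M. (cmod (f \<xi> - fourier_sum z (A n) \<xi>))\<^sup>2) \<le> (1/4) ^ n"
    using square_integrable_limit[of ?M "\<lambda>n. fourier_sum z (A n)",
        OF square_integrable_fourier_sum close[OF A(1,2)]] by blast
  have "((\<lambda>B. LINT \<xi>|?M. (cmod (f \<xi> - fourier_sum z B \<xi>))\<^sup>2) \<longlongrightarrow> 0) (finite_subsets_at_top (Lam N r))"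
  proof (rule tendstoI)
    fix e :: real assume "e > 0"
    \<comment> \<open>Two errors of at most \<open>(1/4) ^ n\<close>, each doubled by the inequality
      for the square of a sum, must add up to less than \<open>e\<close>.\<close>
    then obtain n where n: "(1/4) ^ n < e / 4"
      using real_arch_pow_inv[of "e/4" "1/4"] \<open>e > 0\<close> by fastforce
    have "(LINT \<xi>|?M. (cmod (f \<xi> - fourier_sum z B \<xi>))\<^sup>2) < e"
      if B: "finite B" "A n \<subseteq> B" "B \<subseteq> Lam N r" for B
    proof -
      let ?a = "\<lambda>\<xi>. f \<xi> - fourier_sum z (A n) \<xi>"
      let ?b = "\<lambda>\<xi>. fourier_sum z (A n) \<xi> - fourier_sum z B \<xi>"
      have "(LINT \<xi>|?M. (cmod (?a \<xi> + ?b \<xi>))\<^sup>2)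
          \<le> 2 * (LINT \<xi>|?M. (cmod (?a \<xi>))\<^sup>2) + 2 * (LINT \<xi>|?M. (cmod (?b \<xi>))\<^sup>2)"
        by (intro integral_norm_add_squared_le square_integrable_diff f square_integrable_fourier_sum)
      also have "\<dots> \<le> 2 * (1/4) ^ n + 2 * (1/4) ^ n"
        using lim[of n] close[of B n] B by (simp add: norm_minus_commute)
      finally show ?thesis using n by simp
    qed
    then show "\<forall>\<^sub>F B in finite_subsets_at_top (Lam N r).
        dist (LINT \<xi>|?M. (cmod (f \<xi> - fourier_sum z B \<xi>))\<^sup>2) 0 < e"
      using A by (intro eventually_finite_subsets_at_top[THEN iffD2] exI[of _ "A n"]) auto
  qed
  with f show ?thesis by (auto simp: fourier_limit_def)
qed

lemma fourier_limit_add: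
  assumes "fourier_limit N r z f" "fourier_limit N r w g"
  shows "fourier_limit N r (\<lambda>l. z l + w l) (\<lambda>\<xi>. f \<xi> + g \<xi>)"
proof -
  let ?M = "lebesgue_on (Omega N)" and ?F = "finite_subsets_at_top (Lam N r)"
  have f: "square_integrable ?M f" and g: "square_integrable ?M g"
    and lf: "((\<lambda>A. LINT \<xi>|?M. (cmod (f \<xi> - fourier_sum z A \<xi>))\<^sup>2) \<longlongrightarrow> 0) ?F"
    and lg: "((\<lambda>A. LINT \<xi>|?M. (cmod (g \<xi> - fourier_sum w A \<xi>))\<^sup>2) \<longlongrightarrow> 0) ?F"
    using assms by (auto simp: fourier_limit_def)
  have "((\<lambda>A. LINT \<xi>|?M. (cmod (f \<xi> + g \<xi> - fourier_sum (\<lambda>l. z l + w l) A \<xi>))\<^sup>2) \<longlongrightarrow> 0) ?F"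
  proof (rule tendsto_sandwich[OF _ _ tendsto_const])
    show "((\<lambda>A. 2 * (LINT \<xi>|?M. (cmod (f \<xi> - fourier_sum z A \<xi>))\<^sup>2)
          + 2 * (LINT \<xi>|?M. (cmod (g \<xi> - fourier_sum w A \<xi>))\<^sup>2)) \<longlongrightarrow> 0) ?F"
      using tendsto_add[OF tendsto_mult_left[OF lf, of 2] tendsto_mult_left[OF lg, of 2]] by simp
    have *: "f \<xi> + g \<xi> - fourier_sum (\<lambda>l. z l + w l) A \<xi>
        = (f \<xi> - fourier_sum z A \<xi>) + (g \<xi> - fourier_sum w A \<xi>)" for A \<xi>
      by (simp add: fourier_sum_def ring_distribs sum.distrib)
    show "\<forall>\<^sub>F A in ?F. (LINT \<xi>|?M. (cmod (f \<xi> + g \<xi> - fourier_sum (\<lambda>l. z l + w l) A \<xi>))\<^sup>2)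
        \<le> 2 * (LINT \<xi>|?M. (cmod (f \<xi> - fourier_sum z A \<xi>))\<^sup>2)
          + 2 * (LINT \<xi>|?M. (cmod (g \<xi> - fourier_sum w A \<xi>))\<^sup>2)"
      unfolding * by (intro always_eventually allI integral_norm_add_squared_le
          square_integrable_diff f g square_integrable_fourier_sum)
  qed auto
  with square_integrable_add[OF f g] show ?thesis
    by (simp add: fourier_limit_def)
qed

lemma fourier_limit_cmult:
  assumes "fourier_limit N r z f"
  shows "fourier_limit N r (\<lambda>l. c * z l) (\<lambda>\<xi>. c * f \<xi>)"
proof -
  have *: "c * f \<xi> - fourier_sum (\<lambda>l. c * z l) A \<xi> = c * (f \<xi> - fourier_sum z A \<xi>)" for A \<xi>
    by (simp add: fourier_sum_def sum_distrib_left algebra_simps)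
  have lim: "((\<lambda>A. LINT \<xi>|lebesgue_on (Omega N). (cmod (f \<xi> - fourier_sum z A \<xi>))\<^sup>2) \<longlongrightarrow> 0)
      (finite_subsets_at_top (Lam N r))"
    using assms by (simp add: fourier_limit_def)
  show ?thesis
    using assms tendsto_mult_left[OF lim, of "(cmod c)\<^sup>2"]
    by (simp add: fourier_limit_def square_integrable_cmult * norm_mult power_mult_distrib)
qed

lemma fourier_limit_sum:
  assumes "finite K" "\<And>k. k \<in> K \<Longrightarrow> fourier_limit N r (z k) (f k)"
  shows "fourier_limit N r (\<lambda>l. \<Sum>k\<in>K. z k l) (\<lambda>\<xi>. \<Sum>k\<in>K. f k \<xi>)"
  using assms
proof (induction K)
  case empty
  show ?case by (simp add: fourier_limit_def fourier_sum_def square_integrable_def)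
next
  case (insert k K)
  then show ?case by (simp add: fourier_limit_add)
qed

lemma fourier_limit_cong:
  assumes "fourier_limit N r z f" "\<And>l. l \<in> Lam N r \<Longrightarrow> z l = w l"
  shows "fourier_limit N r w f"
proof -
  have "\<forall>\<^sub>F A in finite_subsets_at_top (Lam N r). fourier_sum z A = fourier_sum w A"
    using assms(2) by (intro eventually_finite_subsets_at_top[THEN iffD2] exI[of _ "{}"])
      (auto simp: fourier_sum_def fun_eq_iff intro!: sum.cong)
  then have "\<forall>\<^sub>F A in finite_subsets_at_top (Lam N r).
      (LINT \<xi>|lebesgue_on (Omega N). (cmod (f \<xi> - fourier_sum z A \<xi>))\<^sup>2)
      = (LINT \<xi>|lebesgue_on (Omega N). (cmod (f \<xi> - fourier_sum w A \<xi>))\<^sup>2)"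
    by eventually_elim simp
  from tendsto_cong[OF this] assms(1) show ?thesis
    by (simp add: fourier_limit_def)
qed

lemma Lam_add_even: "l + 2 * of_int k \<in> Lam N r \<longleftrightarrow> l \<in> Lam N r"
proof -
  have *: "l + 2 * of_int k \<in> Lam N r" if "l \<in> Lam N r" for l k
  proof -
    from that obtain a n where "a \<in> {0, real r / real N}" "l = a + 2 * of_int n"
      by (auto simp: Lam_def)
    then have "l + 2 * of_int k = a + 2 * of_int (n + k)" by simp
    with \<open>a \<in> _\<close> show ?thesis unfolding Lam_def by blast
  qed
  from *[of l k] *[of "l + 2 * of_int k" "- k"] show ?thesis by auto
qed

text \<open>Reindexing a partial sum by the translation pulls out the factor
  \<open>cis (4 * pi * k * \<xi>)\<close>, which has modulus 1; the errors are therefore those of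
  the original series along translated index sets.\<close>

lemma fourier_limit_shift:
  assumes "fourier_limit N r z f"
  shows "fourier_limit N r (\<lambda>l. z (l - 2 * of_int k)) (\<lambda>\<xi>. cis (4 * pi * of_int k * \<xi>) * f \<xi>)"
proof -
  let ?M = "lebesgue_on (Omega N)" and ?F = "finite_subsets_at_top (Lam N r)"
  let ?h = "\<lambda>l. l + 2 * of_int k :: real" and ?e = "\<lambda>\<xi>. cis (4 * pi * of_int k * \<xi>)"
  let ?I = "\<lambda>A. LINT \<xi>|?M. (cmod (f \<xi> - fourier_sum z A \<xi>))\<^sup>2"
  have lim: "(?I \<longlongrightarrow> 0) ?F" and f: "square_integrable ?M f"
    using assms by (auto simp: fourier_limit_def)
  \<comment> \<open>Translation by an even integer permutes \<open>Lam N r\<close>, so translated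
    index sets still exhaust it.\<close>
  have "filterlim (\<lambda>A. (\<lambda>l. l - 2 * of_int k) ` A) ?F ?F"
    unfolding filterlim_iff eventually_finite_subsets_at_top
  proof safe
    fix P and X :: "real set"
    assume X: "finite X" "X \<subseteq> Lam N r" "\<forall>Y. finite Y \<and> X \<subseteq> Y \<and> Y \<subseteq> Lam N r \<longrightarrow> P Y"
    show "\<exists>X. finite X \<and> X \<subseteq> Lam N r \<and>
        (\<forall>Y. finite Y \<and> X \<subseteq> Y \<and> Y \<subseteq> Lam N r \<longrightarrow> P ((\<lambda>l. l - 2 * of_int k) ` Y))"
    proof (intro exI[of _ "?h ` X"] conjI allI impI)
      show "finite (?h ` X)" "?h ` X \<subseteq> Lam N r"
        using X Lam_add_even by auto
      fix Y assume Y: "finite Y \<and> ?h ` X \<subseteq> Y \<and> Y \<subseteq> Lam N r"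
      have "x \<in> (\<lambda>l. l - 2 * of_int k) ` Y" if "x \<in> X" for x
        using that Y by (intro image_eqI[of _ _ "?h x"]) auto
      moreover have "(\<lambda>l. l - 2 * of_int k) ` Y \<subseteq> Lam N r"
        using Y Lam_add_even[of _ "- k" N r] by auto
      ultimately show "P ((\<lambda>l. l - 2 * of_int k) ` Y)"
        using Y by (intro X(3)[rule_format]) auto
    qed
  qed
  from filterlim_compose[OF lim this]
  have "((\<lambda>A. ?I ((\<lambda>l. l - 2 * of_int k) ` A)) \<longlongrightarrow> 0) ?F" .
  moreover have "?I ((\<lambda>l. l - 2 * of_int k) ` A)
      = (LINT \<xi>|?M. (cmod (?e \<xi> * f \<xi> - fourier_sum (\<lambda>l. z (l - 2 * of_int k)) A \<xi>))\<^sup>2)" for A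
  proof -
    have "fourier_sum (\<lambda>l. z (l - 2 * of_int k)) A \<xi>
        = ?e \<xi> * fourier_sum z ((\<lambda>l. l - 2 * of_int k) ` A) \<xi>" for \<xi>
      unfolding fourier_sum_def
      by (subst sum.reindex) (auto simp: inj_on_def sum_distrib_left cis_mult mult.left_commute
          algebra_simps intro!: sum.cong)
    then show ?thesis
      by (simp add: norm_mult flip: right_diff_distrib)
  qed
  moreover have "square_integrable ?M (\<lambda>\<xi>. ?e \<xi> * f \<xi>)"
    by (rule square_integrable_mult_bounded[OF f, where B = 1]) auto
  ultimately show ?thesis by (simp add: fourier_limit_def)
qed

text \<open>One half of Parseval's identity, known for partial sums by orthonormality. Splitting
  \<open>f\<close> with weights \<open>1 + e\<close> and \<open>1 + 1/e\<close>, passing to the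
  limit over finite sets and then letting \<open>e\<close> tend to 0 keeps the constant 1.\<close>

lemma fourier_limit_norm_le:
  assumes "N \<ge> 1" "odd r" and f: "fourier_limit N r z f"
    and summ: "(\<lambda>l. (cmod (z l))\<^sup>2) summable_on Lam N r"
  shows "(LINT \<xi>|lebesgue_on (Omega N). (cmod (f \<xi>))\<^sup>2) \<le> (\<Sum>\<^sub>\<infinity>l\<in>Lam N r. (cmod (z l))\<^sup>2)"
proof -
  let ?M = "lebesgue_on (Omega N)" and ?F = "finite_subsets_at_top (Lam N r)"
  let ?S = "\<Sum>\<^sub>\<infinity>l\<in>Lam N r. (cmod (z l))\<^sup>2"
  have sq: "square_integrable ?M f"
    and lim: "((\<lambda>A. LINT \<xi>|?M. (cmod (f \<xi> - fourier_sum z A \<xi>))\<^sup>2) \<longlongrightarrow> 0) ?F"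
    using f by (auto simp: fourier_limit_def)
  have le: "(LINT \<xi>|?M. (cmod (f \<xi>))\<^sup>2) \<le> (1 + e) * ?S" if "e > 0" for e
  proof -
    let ?I = "\<lambda>A. LINT \<xi>|?M. (cmod (f \<xi> - fourier_sum z A \<xi>))\<^sup>2"
    have "((\<lambda>A. (1 + e) * ?S + (1 + 1/e) * ?I A) \<longlongrightarrow> (1 + e) * ?S) ?F"
      using tendsto_add[OF tendsto_const[of "(1 + e) * ?S"] tendsto_mult_left[OF lim, of "1 + 1/e"]]
      by simp
    moreover have "(LINT \<xi>|?M. (cmod (f \<xi>))\<^sup>2) \<le> (1 + e) * ?S + (1 + 1/e) * ?I A"
      if A: "finite A" "A \<subseteq> Lam N r" for A
    proof -
      have pt: "(cmod a)\<^sup>2 \<le> (1 + e) * (cmod b)\<^sup>2 + (1 + 1/e) * (cmod (a - b))\<^sup>2" for a b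
      proof -
        have "(cmod a)\<^sup>2 \<le> (cmod b + cmod (a - b))\<^sup>2"
          by (metis norm_ge_zero norm_triangle_sub power_mono)
        also have "\<dots> \<le> (1 + e) * (cmod b)\<^sup>2 + (1 + 1/e) * (cmod (a - b))\<^sup>2"
        proof -
          \<comment> \<open>Young's inequality with weight \<open>e\<close> for the cross
            term.\<close>
          have "0 \<le> (e * cmod b - cmod (a - b))\<^sup>2 / e"
            using \<open>e > 0\<close> by simp
          also have "\<dots> = e * (cmod b)\<^sup>2 - 2 * cmod b * cmod (a - b) + (1/e) * (cmod (a - b))\<^sup>2"
            using \<open>e > 0\<close> by (simp add: power2_eq_square field_simps)
          finally show ?thesis
            by (simp add: power2_sum algebra_simps)
        qed
        finally show ?thesis .
      qed
      note sqs = square_integrableD(2)[OF sq]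
        square_integrableD(2)[OF square_integrable_fourier_sum[of N z A]]
        square_integrableD(2)[OF square_integrable_diff[OF sq square_integrable_fourier_sum[of N z A]]]
      have "(LINT \<xi>|?M. (cmod (f \<xi>))\<^sup>2)
          \<le> (LINT \<xi>|?M. (1 + e) * (cmod (fourier_sum z A \<xi>))\<^sup>2
              + (1 + 1/e) * (cmod (f \<xi> - fourier_sum z A \<xi>))\<^sup>2)"
        using sqs by (intro integral_mono pt Bochner_Integration.integrable_add integrable_mult_right) auto
      also have "\<dots> = (1 + e) * (LINT \<xi>|?M. (cmod (fourier_sum z A \<xi>))\<^sup>2) + (1 + 1/e) * ?I A"
        using sqs by simp
      also have "(LINT \<xi>|?M. (cmod (fourier_sum z A \<xi>))\<^sup>2) \<le> ?S"
        unfolding integral_fourier_sum_squared[OF assms(1,2) A]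
        by (rule finite_sum_le_infsum) (use A summ in auto)
      finally show ?thesis using \<open>e > 0\<close> by (simp add: mult_left_mono)
    qed
    then have "\<forall>\<^sub>F A in ?F. (LINT \<xi>|?M. (cmod (f \<xi>))\<^sup>2) \<le> (1 + e) * ?S + (1 + 1/e) * ?I A"
      by (intro eventually_finite_subsets_at_top_weakI) auto
    ultimately show ?thesis
      by (rule tendsto_lowerbound) simp
  qed
  have "((\<lambda>e. (1 + e) * ?S) \<longlongrightarrow> (1 + 0) * ?S) (at_right 0)"
    by (intro tendsto_intros)
  then have "(LINT \<xi>|?M. (cmod (f \<xi>))\<^sup>2) \<le> (1 + 0) * ?S"
    by (rule tendsto_lowerbound) (auto intro!: eventually_at_rightI[of 0 1] le)
  then show ?thesis by simp
qed

section \<open>Vector-valued sequences and the Bessel condition\<close>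

lemma norm_vec_squared: "(norm (x :: complex ^ 's))\<^sup>2 = (\<Sum>k\<in>UNIV. (cmod (x $ k))\<^sup>2)"
  by (simp add: norm_vec_def L2_set_def sum_nonneg)

text \<open>Reduces the vector-valued transform to the scalar theory: a vector function is
  measurable and square-integrable exactly when its finitely many coordinates are.\<close>

lemma is_fourier_iff_fourier_limit:
  fixes f :: "real \<Rightarrow> complex ^ 's"
  shows "is_fourier N r Z f \<longleftrightarrow> (\<forall>k. fourier_limit N r (\<lambda>l. Z l $ k) (\<lambda>\<xi>. f \<xi> $ k))"
proof -
  let ?M = "lebesgue_on (Omega N)"
  have "f \<in> L2_Omega N \<longleftrightarrow> (\<forall>k. square_integrable ?M (\<lambda>\<xi>. f \<xi> $ k))"
  proof
    assume f: "f \<in> L2_Omega N"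
    then have [measurable]: "f \<in> borel_measurable ?M"
      and int: "integrable ?M (\<lambda>\<xi>. (norm (f \<xi>))\<^sup>2)"
      by (auto simp: L2_Omega_def)
    have meas: "(\<lambda>\<xi>. f \<xi> $ k) \<in> borel_measurable ?M" for k
      by (rule measurable_compose[of f ?M borel])
        (auto intro!: borel_measurable_continuous_onI continuous_intros)
    have "integrable ?M (\<lambda>\<xi>. (cmod (f \<xi> $ k))\<^sup>2)" for k
    proof (rule Bochner_Integration.integrable_bound[OF int])
      show "(\<lambda>\<xi>. (cmod (f \<xi> $ k))\<^sup>2) \<in> borel_measurable ?M"
        using meas[of k] by measurable
      show "AE \<xi> in ?M. norm ((cmod (f \<xi> $ k))\<^sup>2) \<le> norm ((norm (f \<xi>))\<^sup>2)"
        by (simp add: power_mono Finite_Cartesian_Product.norm_nth_le)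
    qed
    with meas show "\<forall>k. square_integrable ?M (\<lambda>\<xi>. f \<xi> $ k)"
      by (simp add: square_integrable_def)
  next
    assume sq: "\<forall>k. square_integrable ?M (\<lambda>\<xi>. f \<xi> $ k)"
    then have [measurable]: "(\<lambda>\<xi>. f \<xi> $ k) \<in> borel_measurable ?M" for k
      by (simp add: square_integrable_def)
    have "f \<in> borel_measurable ?M"
    proof (rule borel_measurable_euclidean_space[THEN iffD2], rule ballI)
      fix v :: "complex ^ 's" assume "v \<in> Basis"
      then obtain k u where "v = axis k u"
        by (auto simp: Basis_vec_def)
      then show "(\<lambda>\<xi>. f \<xi> \<bullet> v) \<in> borel_measurable ?M"
        by (simp add: inner_axis)
    qed
    moreover have "integrable ?M (\<lambda>\<xi>. (norm (f \<xi>))\<^sup>2)"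
      unfolding norm_vec_squared using sq by (auto simp: square_integrable_def)
    ultimately show "f \<in> L2_Omega N"
      by (simp add: L2_Omega_def)
  qed
  then show ?thesis
    by (auto simp: is_fourier_def fourier_limit_def fourier_sum_def)
qed

lemma ell2_iff:
  "Z \<in> ell2 N r \<longleftrightarrow> Z \<in> extensional (Lam N r) \<and> (\<lambda>l. (norm (Z l))\<^sup>2) summable_on Lam N r"
  by (simp add: ell2_def norm_vec_squared)

lemma ell2_coord_summable:
  assumes "Z \<in> ell2 N r"
  shows "(\<lambda>l. (cmod (Z l $ k))\<^sup>2) summable_on Lam N r"
  by (rule summable_on_comparison_test[of "\<lambda>l. (norm (Z l))\<^sup>2"])
    (use assms in \<open>auto simp: ell2_iff power_mono Finite_Cartesian_Product.norm_nth_le\<close>)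

text \<open>The choice made in \<open>fourier\<close> is legitimate: the coordinate limits exist and
  assemble into one vector-valued function.\<close>

lemma is_fourier_fourier:
  assumes "N \<ge> 1" "odd r" "Z \<in> ell2 N r"
  shows "is_fourier N r Z (fourier N r Z)"
proof -
  have "\<forall>k. \<exists>g. fourier_limit N r (\<lambda>l. Z l $ k) g"
    by (intro allI fourier_limit_exists assms(1,2) ell2_coord_summable[OF assms(3)])
  then obtain g where "\<And>k. fourier_limit N r (\<lambda>l. Z l $ k) (g k)"
    by metis
  then have "is_fourier N r Z (\<lambda>\<xi>. \<chi> k. g k \<xi>)"
    by (simp add: is_fourier_iff_fourier_limit)
  then show ?thesis
    unfolding fourier_def by (rule someI[of "is_fourier N r Z"])
qed

lemma has_sum_sum:
  fixes f :: "'i \<Rightarrow> 'a \<Rightarrow> 'b :: topological_comm_monoid_add"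
  assumes "finite I" "\<And>i. i \<in> I \<Longrightarrow> (f i has_sum s i) A"
  shows "((\<lambda>x. \<Sum>i\<in>I. f i x) has_sum (\<Sum>i\<in>I. s i)) A"
  using assms by (induction I) (auto intro: has_sum_add)

text \<open>The sum defining the inner product of \<open>Z\<close> with itself is real and
  nonnegative, so the real part and the root in \<open>ell2_norm\<close> lose nothing. The
  coordinatewise form fits the bound of \<open>fourier_limit_norm_le\<close>.\<close>

lemma ell2_norm_squared:
  assumes "Z \<in> ell2 N r"
  shows "ell2_inner N r Z Z = of_real ((ell2_norm N r Z)\<^sup>2)"
    and "(ell2_norm N r Z)\<^sup>2 = (\<Sum>k\<in>UNIV. \<Sum>\<^sub>\<infinity>l\<in>Lam N r. (cmod (Z l $ k))\<^sup>2)"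
proof -
  let ?s = "\<Sum>k\<in>UNIV. \<Sum>\<^sub>\<infinity>l\<in>Lam N r. (cmod (Z l $ k))\<^sup>2"
  have "((\<lambda>l. \<Sum>k\<in>UNIV. (cmod (Z l $ k))\<^sup>2) has_sum ?s) (Lam N r)"
    by (intro has_sum_sum has_sum_infsum ell2_coord_summable assms) auto
  from has_sum_of_real[OF this, where 'a = complex]
  have "ell2_inner N r Z Z = of_real ?s"
    unfolding ell2_inner_def
    by (intro infsumI) (simp add: complex_norm_square del: of_real_power flip: of_real_power)
  moreover have "?s \<ge> 0"
    by (intro sum_nonneg infsum_nonneg) auto
  ultimately show "(ell2_norm N r Z)\<^sup>2 = ?s" "ell2_inner N r Z Z = of_real ((ell2_norm N r Z)\<^sup>2)"
    by (auto simp: ell2_norm_def)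
qed

text \<open>Absolute convergence by \<open>2 * a * b \<le> a\<^sup>2 + b\<^sup>2\<close>; it ensures
  that \<open>ell2_inner\<close> is a genuine sum and not the default value of
  \<open>infsum\<close>.\<close>

lemma ell2_inner_has_sum:
  assumes Z: "Z \<in> ell2 N r" and V: "V \<in> ell2 N r"
  shows "((\<lambda>l. \<Sum>k\<in>UNIV. Z l $ k * cnj (V l $ k)) has_sum ell2_inner N r Z V) (Lam N r)"
proof -
  have "(\<lambda>l. Z l $ k * cnj (V l $ k)) summable_on Lam N r" for k
  proof (rule abs_summable_summable, rule summable_on_comparison_test)
    show "(\<lambda>l. (cmod (Z l $ k))\<^sup>2 + (cmod (V l $ k))\<^sup>2) summable_on Lam N r"
      by (intro summable_on_add ell2_coord_summable Z V)
    fix l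
    have "2 * cmod (Z l $ k) * cmod (V l $ k) \<le> (cmod (Z l $ k))\<^sup>2 + (cmod (V l $ k))\<^sup>2"
      by (rule sum_squares_bound)
    moreover have "0 \<le> cmod (Z l $ k) * cmod (V l $ k)"
      by simp
    ultimately show "norm (Z l $ k * cnj (V l $ k)) \<le> (cmod (Z l $ k))\<^sup>2 + (cmod (V l $ k))\<^sup>2"
      unfolding norm_mult complex_mod_cnj by linarith
  qed auto
  then have "((\<lambda>l. \<Sum>k\<in>UNIV. Z l $ k * cnj (V l $ k)) has_sum
      (\<Sum>k\<in>UNIV. \<Sum>\<^sub>\<infinity>l\<in>Lam N r. Z l $ k * cnj (V l $ k))) (Lam N r)"
    by (intro has_sum_sum has_sum_infsum) auto
  then show ?thesis
    unfolding ell2_inner_def using has_sum_infsum summable_on_def by blast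
qed

lemma norm_scalar_mult_vec: "norm (c *s (x :: complex ^ 's)) = cmod c * norm x"
proof -
  have "(norm (c *s x))\<^sup>2 = (cmod c * norm x)\<^sup>2"
    by (simp add: norm_vec_squared power_mult_distrib norm_mult sum_distrib_left)
  then show ?thesis by (simp add: power2_eq_iff_nonneg)
qed

lemma ell2_sum:
  fixes V :: "'i \<Rightarrow> real \<Rightarrow> complex ^ 's"
  assumes "finite I" "\<And>i. i \<in> I \<Longrightarrow> V i \<in> ell2 N r"
  shows "(\<lambda>l\<in>Lam N r. \<Sum>i\<in>I. c i *s V i l) \<in> ell2 N r"
proof -
  have "(\<lambda>l. (norm (\<Sum>i\<in>I. c i *s V i l))\<^sup>2) summable_on Lam N r"
    using assms
  proof (induction I)
    case (insert i I)
    have "(\<lambda>l. 2 * ((cmod (c i))\<^sup>2 * (norm (V i l))\<^sup>2) + 2 * (norm (\<Sum>i\<in>I. c i *s V i l))\<^sup>2)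
        summable_on Lam N r"
      using insert.prems[of i] insert.IH insert.prems
      by (intro summable_on_add summable_on_cmult_right) (auto simp: ell2_iff)
    then show ?case
    proof (rule summable_on_comparison_test)
      fix l
      show "(norm (\<Sum>i\<in>insert i I. c i *s V i l))\<^sup>2
          \<le> 2 * ((cmod (c i))\<^sup>2 * (norm (V i l))\<^sup>2) + 2 * (norm (\<Sum>i\<in>I. c i *s V i l))\<^sup>2"
        using norm_add_squared_le[of "c i *s V i l"] insert.hyps
        by (simp add: norm_scalar_mult_vec power_mult_distrib)
    qed auto
  qed auto
  then show ?thesis
    by (simp add: ell2_iff cong: summable_on_cong)
qed

lemma ell2_inner_sum_right:
  assumes "finite I" "Z \<in> ell2 N r" "\<And>i. i \<in> I \<Longrightarrow> V i \<in> ell2 N r"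
  shows "ell2_inner N r Z (\<lambda>l\<in>Lam N r. \<Sum>i\<in>I. c i *s V i l) = (\<Sum>i\<in>I. cnj (c i) * ell2_inner N r Z (V i))"
proof -
  have "((\<lambda>l. \<Sum>i\<in>I. cnj (c i) * (\<Sum>k\<in>UNIV. Z l $ k * cnj (V i l $ k))) has_sum
      (\<Sum>i\<in>I. cnj (c i) * ell2_inner N r Z (V i))) (Lam N r)"
    using assms by (intro has_sum_sum has_sum_cmult_right ell2_inner_has_sum) auto
  moreover have "(\<Sum>i\<in>I. cnj (c i) * (\<Sum>k\<in>UNIV. Z l $ k * cnj (V i l $ k)))
      = (\<Sum>k\<in>UNIV. Z l $ k * cnj ((\<Sum>i\<in>I. c i *s V i l) $ k))" for l
    unfolding sum_distrib_left by (subst sum.swap) (simp add: sum_distrib_left mult.left_commute)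
  ultimately show ?thesis
    unfolding ell2_inner_def by (intro infsumI) (simp cong: has_sum_cong)
qed

text \<open>Duality: the Bessel condition is only needed at the synthesized vector \<open>Z\<close> itself.\<close>

lemma ell2_norm_synthesis_le:
  fixes V :: "'i \<Rightarrow> real \<Rightarrow> complex ^ 's" and c :: "'i \<Rightarrow> complex"
  assumes "finite I" "\<And>i. i \<in> I \<Longrightarrow> V i \<in> ell2 N r" "B \<ge> 0"
  defines "Z \<equiv> (\<lambda>l\<in>Lam N r. \<Sum>i\<in>I. c i *s V i l)"
  assumes bessel: "(\<Sum>i\<in>I. (cmod (ell2_inner N r Z (V i)))\<^sup>2) \<le> B * (ell2_norm N r Z)\<^sup>2"
  shows "(ell2_norm N r Z)\<^sup>2 \<le> B * (\<Sum>i\<in>I. (cmod (c i))\<^sup>2)"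
proof -
  define X where "X = (ell2_norm N r Z)\<^sup>2"
  have Z: "Z \<in> ell2 N r"
    unfolding Z_def using assms by (intro ell2_sum)
  have "X = cmod (ell2_inner N r Z Z)"
    using ell2_norm_squared(1)[OF Z] by (simp add: X_def norm_power)
  also have "ell2_inner N r Z Z = (\<Sum>i\<in>I. cnj (c i) * ell2_inner N r Z (V i))"
    using ell2_inner_sum_right[OF assms(1) Z, of V c] assms(2) by (simp flip: Z_def)
  also have "cmod \<dots> \<le> (\<Sum>i\<in>I. cmod (c i) * cmod (ell2_inner N r Z (V i)))"
    by (rule order_trans[OF norm_sum]) (simp add: norm_mult)
  \<comment> \<open>Squaring admits Cauchy--Schwarz; the Bessel bound then gives back a single
    factor \<open>X\<close>, so one factor on the left survives cancellation.\<close>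
  finally have "X\<^sup>2 \<le> (\<Sum>i\<in>I. cmod (c i) * cmod (ell2_inner N r Z (V i)))\<^sup>2"
    by (intro power_mono) (auto simp: X_def)
  also have "\<dots> \<le> (\<Sum>i\<in>I. (cmod (c i))\<^sup>2) * (\<Sum>i\<in>I. (cmod (ell2_inner N r Z (V i)))\<^sup>2)"
    by (rule Cauchy_Schwarz_ineq_sum)
  also have "\<dots> \<le> (\<Sum>i\<in>I. (cmod (c i))\<^sup>2) * (B * X)"
    using bessel by (intro mult_left_mono sum_nonneg) (auto simp: X_def)
  finally have "X * X \<le> X * (B * (\<Sum>i\<in>I. (cmod (c i))\<^sup>2))"
    by (simp add: power2_eq_square mult_ac)
  moreover have "0 \<le> B * (\<Sum>i\<in>I. (cmod (c i))\<^sup>2)"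
    using \<open>B \<ge> 0\<close> by (intro mult_nonneg_nonneg sum_nonneg) auto
  moreover have "X \<ge> 0"
    by (simp add: X_def)
  ultimately show ?thesis
    unfolding X_def[symmetric] by (cases "X = 0") (auto simp: mult_le_cancel_left)
qed

section \<open>Modulated and translated windows, and transfer of the Bessel bound to
  \<Omega>\<close>

lemma ell2_Emod:
  assumes "Z \<in> ell2 N r"
  shows "Emod N r a Z \<in> ell2 N r"
  using assms by (auto simp: ell2_iff Emod_def norm_scalar_mult_vec cong: summable_on_cong)

lemma bij_betw_Lam_shift: "bij_betw (\<lambda>l. l - 2 * of_int k) (Lam N r) (Lam N r)"
  by (rule bij_betw_byWitness[of _ "\<lambda>l. l + 2 * of_int k"])
    (use Lam_add_even[of _ k] Lam_add_even[of _ "- k"] in auto)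

text \<open>\<open>Rshift\<close> translates by \<open>2 * N\<close> times its parameter; the even
  parameter \<open>2 * k\<close> makes this the even integer \<open>4 * N * k\<close>, and such a
  translation permutes \<open>Lam N r\<close>.\<close>

lemma ell2_Rshift:
  assumes Z: "Z \<in> ell2 N r"
  shows "Rshift N r (2 * real k) Z \<in> ell2 N r"
proof -
  have "(\<lambda>l. (norm (Z (l - 2 * of_int (2 * int N * int k))))\<^sup>2) summable_on Lam N r"
    using Z summable_on_reindex_bij_betw[OF bij_betw_Lam_shift[of "2 * int N * int k" N r],
        of "\<lambda>l. (norm (Z l))\<^sup>2"]
    by (simp only: ell2_iff)
  then have "(\<lambda>l. (norm (Z (l - 2 * real N * (2 * real k))))\<^sup>2) summable_on Lam N r"
    by (simp add: mult_ac)
  then show ?thesis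
    by (simp add: ell2_iff Rshift_def cong: summable_on_cong)
qed

lemma even_in_Lam: "2 * real k \<in> Lam N r"
  unfolding Lam_def by (rule CollectI, intro exI[of _ 0] exI[of _ "int k"]) simp

text \<open>\<open>poly p (cis (8 * pi * N * \<xi>)) * f \<xi>\<close> is the transform of
  \<open>Z\<close>, the combination of translates of the modulated window by
  \<open>4 * N * i\<close> with coefficients \<open>coeff p i\<close>. The transform does not
  increase the norm, and duality bounds the norm of \<open>Z\<close>.\<close>

lemma polynomial_multiplier_le:
  fixes W :: "nat \<Rightarrow> real \<Rightarrow> complex ^ 's"
  assumes "N \<ge> 1" "odd r" and bessel: "dvnug_bessel N r M P W B"
    and m: "m \<in> T1 M" and j: "j \<in> T2 P" and W: "W j \<in> ell2 N r"
    and f: "is_fourier N r (Emod N r (real m / real M) (W j)) f"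
  shows "(LINT \<xi>|lebesgue_on (Omega N). (cmod (poly p (cis (8 * pi * real N * \<xi>))))\<^sup>2 * (norm (f \<xi>))\<^sup>2)
           \<le> B * (\<Sum>i\<le>degree p. (cmod (coeff p i))\<^sup>2)"
proof -
  let ?M = "lebesgue_on (Omega N)" and ?a = "real m / real M"
  let ?q = "\<lambda>\<xi>. poly p (cis (8 * pi * real N * \<xi>))"
  define V where "V i = dvnug N r M W (m, j, 2 * real i)" for i :: nat
  \<comment> \<open>Modulating after translating differs from translating after modulating by a
    phase. It is absorbed into \<open>c\<close>, which leaves the modulus of each coefficient
    unchanged.\<close>
  define c where "c i = coeff p i * cis (- (2 * pi * ?a * (4 * real N * real i)))" for i :: nat
  define Z where "Z = (\<lambda>l\<in>Lam N r. \<Sum>i\<le>degree p. c i *s V i l)"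
  have V: "V i \<in> ell2 N r" for i
    unfolding V_def dvnug_def using ell2_Emod[OF ell2_Rshift[OF W]] by simp
  have Z: "Z \<in> ell2 N r"
    unfolding Z_def using V by (intro ell2_sum) auto
  \<comment> \<open>Finitely many members of the system with distinct indices occur, so their terms
    form part of the full nonnegative Bessel sum.\<close>
  have "(\<Sum>i\<le>degree p. (cmod (ell2_inner N r Z (V i)))\<^sup>2)
      = (\<Sum>x\<in>(\<lambda>i. (m, j, 2 * real i)) ` {..degree p}. (cmod (ell2_inner N r Z (dvnug N r M W x)))\<^sup>2)"
    by (subst sum.reindex) (auto simp: V_def inj_on_def)
  also have "\<dots> \<le> (\<Sum>\<^sub>\<infinity>x\<in>T1 M \<times> T2 P \<times> Lam N r. (cmod (ell2_inner N r Z (dvnug N r M W x)))\<^sup>2)"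
    using bessel Z m j even_in_Lam unfolding dvnug_bessel_def
    by (intro finite_sum_le_infsum) auto
  also have "\<dots> \<le> B * (ell2_norm N r Z)\<^sup>2"
    using bessel Z by (auto simp: dvnug_bessel_def)
  finally have "(ell2_norm N r Z)\<^sup>2 \<le> B * (\<Sum>i\<le>degree p. (cmod (c i))\<^sup>2)"
    unfolding Z_def using bessel V by (intro ell2_norm_synthesis_le) (auto simp: dvnug_bessel_def)
  then have norm_Z: "(ell2_norm N r Z)\<^sup>2 \<le> B * (\<Sum>i\<le>degree p. (cmod (coeff p i))\<^sup>2)"
    by (simp add: c_def norm_mult)
  have lim: "fourier_limit N r (\<lambda>l. Z l $ k) (\<lambda>\<xi>. ?q \<xi> * f \<xi> $ k)" for k
  proof -
    let ?u = "\<lambda>l. Emod N r ?a (W j) l $ k"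
    let ?n = "\<lambda>i. 2 * int N * int i"
    \<comment> \<open>\<open>fourier_limit_shift\<close> translates by twice its parameter, hence
      \<open>2 * N * i\<close> for a translation by \<open>4 * N * i\<close>; the resulting
      exponential is the \<open>i\<close>-th power of
      \<open>cis (8 * pi * N * \<xi>)\<close>.\<close>
    have lim_sum: "fourier_limit N r (\<lambda>l. \<Sum>i\<le>degree p. coeff p i * ?u (l - 2 * of_int (?n i)))
        (\<lambda>\<xi>. \<Sum>i\<le>degree p. coeff p i * (cis (4 * pi * of_int (?n i) * \<xi>) * f \<xi> $ k))"
      using f unfolding is_fourier_iff_fourier_limit
      by (intro fourier_limit_sum fourier_limit_cmult fourier_limit_shift) auto
    have q: "(\<Sum>i\<le>degree p. coeff p i * (cis (4 * pi * of_int (?n i) * \<xi>) * f \<xi> $ k)) = ?q \<xi> * f \<xi> $ k"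
      for \<xi>
      by (simp add: poly_altdef sum_distrib_right sum_distrib_left Complex.DeMoivre mult_ac)
    have "(\<Sum>i\<le>degree p. coeff p i * ?u (l - 2 * of_int (?n i))) = Z l $ k"
      if l: "l \<in> Lam N r" for l
    proof -
      have "coeff p i * ?u (l - 2 * of_int (?n i)) = c i * V i l $ k" for i
      proof -
        have eq: "l - 2 * of_int (?n i) = l - 2 * real N * (2 * real i)"
          by simp
        have "l - 2 * real N * (2 * real i) \<in> Lam N r"
          using Lam_add_even[of l "- ?n i" N r] l by (simp add: mult_ac)
        moreover have "cis (2 * pi * ?a * (l - 2 * real N * (2 * real i)))
            = cis (- (2 * pi * ?a * (4 * real N * real i))) * cis (2 * pi * ?a * l)"
          unfolding cis_mult by (rule arg_cong[where f = cis]) (simp add: algebra_simps)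
        ultimately show ?thesis
          unfolding eq c_def V_def dvnug_def using l by (simp add: Emod_def Rshift_def)
      qed
      then have "(\<Sum>i\<le>degree p. coeff p i * ?u (l - 2 * of_int (?n i)))
          = (\<Sum>i\<le>degree p. c i * V i l $ k)"
        by (simp only:)
      with l show ?thesis by (simp add: Z_def)
    qed
    then show ?thesis
      by (rule fourier_limit_cong[OF lim_sum[unfolded q]])
  qed
  have sq: "integrable ?M (\<lambda>\<xi>. (cmod (?q \<xi> * f \<xi> $ k))\<^sup>2)" for k
    using lim[of k] by (simp add: fourier_limit_def square_integrable_def)
  have "(LINT \<xi>|?M. (cmod (?q \<xi>))\<^sup>2 * (norm (f \<xi>))\<^sup>2)
      = (LINT \<xi>|?M. (\<Sum>k\<in>UNIV. (cmod (?q \<xi> * f \<xi> $ k))\<^sup>2))"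
    by (simp add: norm_vec_squared sum_distrib_left norm_mult power_mult_distrib)
  also have "\<dots> = (\<Sum>k\<in>UNIV. LINT \<xi>|?M. (cmod (?q \<xi> * f \<xi> $ k))\<^sup>2)"
    using sq by (intro Bochner_Integration.integral_sum)
  also have "\<dots> \<le> (\<Sum>k\<in>UNIV. \<Sum>\<^sub>\<infinity>l\<in>Lam N r. (cmod (Z l $ k))\<^sup>2)"
    by (intro sum_mono fourier_limit_norm_le assms(1,2) lim ell2_coord_summable Z)
  also have "\<dots> = (ell2_norm N r Z)\<^sup>2"
    using ell2_norm_squared(2)[OF Z] by simp
  finally show ?thesis
    using norm_Z by linarith
qed

section \<open>Localization by trigonometric polynomials\<close>

text \<open>On the unit circle \<open>cnj z\<close> is \<open>1/z\<close>, so real polynomials in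
  the coordinates are Laurent polynomials in \<open>z\<close>; a power of \<open>z\<close> clears
  the negative exponents.\<close>

lemma real_polynomial_function_on_circle:
  fixes q :: "complex \<Rightarrow> real"
  assumes "real_polynomial_function q"
  shows "\<exists>p n. \<forall>z. cmod z = 1 \<longrightarrow> of_real (q z) * z ^ n = poly p z"
  using assms
proof (induction rule: real_polynomial_function.induct)
  case (linear f)
  interpret bounded_linear f by fact
  \<comment> \<open>The coefficients come from multiplying \<open>Re z = (z + 1/z) / 2\<close> and
    \<open>Im z = - \<i> * (z - 1/z) / 2\<close> by \<open>z\<close>.\<close>
  define p where "p = [: of_real (f 1) / 2 + \<i> * of_real (f \<i>) / 2, 0,
      of_real (f 1) / 2 - \<i> * of_real (f \<i>) / 2 :]"
  have "of_real (f z) * z ^ 1 = poly p z" if "cmod z = 1" for z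
  proof -
    have "f z = f (Re z *\<^sub>R 1 + Im z *\<^sub>R \<i>)"
      by (rule arg_cong[where f = f]) (simp add: complex_eq_iff)
    then have f: "f z = Re z * f 1 + Im z * f \<i>"
      by (simp add: add scaleR)
    have 1: "z * cnj z = 1"
      using that by (simp add: complex_norm_square[symmetric])
    have re: "of_real (Re z) = (z + cnj z) / 2" and im: "of_real (Im z) = - \<i> * (z - cnj z) / 2"
      by (simp_all add: complex_eq_iff)
    have "of_real (f z) * z ^ 1 = of_real (f 1) / 2 * (z * z + z * cnj z)
        - \<i> * of_real (f \<i>) / 2 * (z * z - z * cnj z)"
      unfolding f of_real_add of_real_mult re im by (simp add: field_simps)
    also have "\<dots> = poly p z"
      unfolding 1 by (simp add: p_def field_simps)
    finally show ?thesis .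
  qed
  then show ?case by blast
next
  case (const c)
  have "of_real c * z ^ 0 = poly [:of_real c:] z" for z :: complex
    by simp
  then show ?case by blast
next
  case (add f g)
  then obtain p n p' n' where p: "\<And>z. cmod z = 1 \<Longrightarrow> of_real (f z) * z ^ n = poly p z"
    and p': "\<And>z. cmod z = 1 \<Longrightarrow> of_real (g z) * z ^ n' = poly p' z"
    by blast
  have "of_real (f z + g z) * z ^ (n + n') = poly (p * monom 1 n' + p' * monom 1 n) z"
    if "cmod z = 1" for z
    by (simp add: p[OF that, symmetric] p'[OF that, symmetric] poly_monom algebra_simps power_add)
  then show ?case by blast
next
  case (mult f g)
  then obtain p n p' n' where p: "\<And>z. cmod z = 1 \<Longrightarrow> of_real (f z) * z ^ n = poly p z"
    and p': "\<And>z. cmod z = 1 \<Longrightarrow> of_real (g z) * z ^ n' = poly p' z"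
    by blast
  have "of_real (f z * g z) * z ^ (n + n') = poly (p * p') z"
    if "cmod z = 1" for z
    by (simp add: p[OF that, symmetric] p'[OF that, symmetric] algebra_simps power_add)
  then show ?case by blast
qed

text \<open>Stone--Weierstrass approximates \<open>g\<close> by a real polynomial \<open>q\<close>.
  Passing to \<open>p\<close> multiplies by \<open>z ^ n\<close>, which alters the phase, so the
  approximation is stated for moduli.\<close>

lemma poly_modulus_dense_on_circle:
  fixes g :: "complex \<Rightarrow> real"
  assumes "continuous_on (sphere 0 1) g" "e > 0"
  obtains p where "\<And>z. cmod z = 1 \<Longrightarrow> \<bar>cmod (poly p z) - \<bar>g z\<bar>\<bar> < e"
proof -
  obtain q where "real_polynomial_function q" and q: "\<And>z. z \<in> sphere 0 1 \<Longrightarrow> \<bar>g z - q z\<bar> < e"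
    using Stone_Weierstrass_real_polynomial_function[OF compact_sphere assms] by blast
  then obtain p n where p: "\<And>z. cmod z = 1 \<Longrightarrow> of_real (q z) * z ^ n = poly p z"
    using real_polynomial_function_on_circle by blast
  show thesis
  proof
    fix z :: complex assume z: "cmod z = 1"
    then have "cmod (poly p z) = \<bar>q z\<bar>"
      by (simp add: p[symmetric] norm_mult norm_power)
    then show "\<bar>cmod (poly p z) - \<bar>g z\<bar>\<bar> < e"
      using q[of z] z by (auto simp: dist_norm)
  qed
qed

text \<open>Tent functions around \<open>K\<close> decrease to its indicator, and polynomials follow
  them in modulus with error below \<open>1/(n+1)\<close>. The uniform bound 2 serves dominated
  convergence.\<close>

lemma poly_modulus_tendsto_indicator:
  assumes "compact K"
  obtains p :: "nat \<Rightarrow> complex poly" where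
    "\<And>z. cmod z = 1 \<Longrightarrow> (\<lambda>n. cmod (poly (p n) z)) \<longlonglongrightarrow> indicator K z"
    "\<And>n z. cmod z = 1 \<Longrightarrow> cmod (poly (p n) z) \<le> 2"
\<comment> \<open>The distance to the empty set is 0 by convention, so the tent functions would then
  be 1 everywhere.\<close>
proof (cases "K = {}")
  case True
  show thesis
    by (rule that[of "\<lambda>_. 0"]) (auto simp: True)
next
  case False
  define \<phi> where "\<phi> n z = max 0 (1 - real n * infdist z K)" for n z
  have "\<exists>p. \<forall>z. cmod z = 1 \<longrightarrow> \<bar>cmod (poly p z) - \<bar>\<phi> n z\<bar>\<bar> < inverse (real (Suc n))" for n
    by (rule poly_modulus_dense_on_circle[of "\<phi> n" "inverse (real (Suc n))"])
      (auto simp: \<phi>_def intro!: continuous_intros)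
  then obtain p where p: "\<And>n z. cmod z = 1 \<Longrightarrow> \<bar>cmod (poly (p n) z) - \<bar>\<phi> n z\<bar>\<bar> < inverse (real (Suc n))"
    by metis
  have \<phi>: "0 \<le> \<phi> n z" "\<phi> n z \<le> 1" for n z
    using infdist_nonneg[of z K] by (auto simp: \<phi>_def)
  show thesis
  proof (rule that)
    fix n and z :: complex assume z: "cmod z = 1"
    have "inverse (real (Suc n)) \<le> 1"
      by (simp add: field_simps)
    then show "cmod (poly (p n) z) \<le> 2"
      using p[OF z, of n] \<phi>[of n z] by linarith
  next
    fix z :: complex assume z: "cmod z = 1"
    have "(\<lambda>n. \<phi> n z) \<longlonglongrightarrow> indicator K z"
    proof (cases "z \<in> K")
      case True
      then show ?thesis by (simp add: \<phi>_def)
    next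
      case False
      then have pos: "infdist z K > 0"
        using in_closed_iff_infdist_zero[of K z] \<open>K \<noteq> {}\<close> assms infdist_nonneg[of z K]
        by (auto simp: compact_imp_closed less_le)
      obtain m where m: "1 < real m * infdist z K"
        using reals_Archimedean3[OF pos] by blast
      have "\<phi> n z = 0" if "m \<le> n" for n
      proof -
        have "real m * infdist z K \<le> real n * infdist z K"
          using that pos by (intro mult_right_mono) auto
        with m show ?thesis by (simp add: \<phi>_def max_def)
      qed
      then have "eventually (\<lambda>n. \<phi> n z = indicator K z) sequentially"
        using False by (auto intro: eventually_sequentiallyI[of m])
      then show ?thesis by (rule tendsto_eventually)
    qed
    moreover have "(\<lambda>n. cmod (poly (p n) z) - \<phi> n z) \<longlonglongrightarrow> 0"
    proof (rule Lim_null_comparison[OF _ LIMSEQ_inverse_real_of_nat])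
      show "\<forall>\<^sub>F n in sequentially. norm (cmod (poly (p n) z) - \<phi> n z) \<le> inverse (real (Suc n))"
        using p[OF z] \<phi>(1) by (auto intro!: always_eventually less_imp_le)
    qed
    ultimately have "(\<lambda>n. \<phi> n z + (cmod (poly (p n) z) - \<phi> n z)) \<longlonglongrightarrow> indicator K z + 0"
      by (intro tendsto_add)
    then show "(\<lambda>n. cmod (poly (p n) z)) \<longlonglongrightarrow> indicator K z"
      by simp
  qed
qed

section \<open>From multiplier bounds to bounds on compact sets and almost everywhere\<close>

lemma integral_poly_cis_squared:
  assumes "t > 0"
  shows "(LINT x|lebesgue_on {a..a + 1/t}. (cmod (poly p (cis (2 * pi * t * x))))\<^sup>2)
           = (1/t) * (\<Sum>i\<le>degree p. (cmod (coeff p i))\<^sup>2)"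
proof -
  have poly: "poly p (cis (2 * pi * t * x)) = (\<Sum>i\<le>degree p. coeff p i * cis (2 * pi * (t * real i) * x))" for x
    by (simp add: poly_altdef Complex.DeMoivre mult_ac)
  show ?thesis
    unfolding poly
  proof (rule integral_norm_sum_cis_squared)
    show "finite_measure (lebesgue_on {a..a + 1/t})"
      by (intro finite_measure_lebesgue_on) auto
    fix i j
    have "((\<lambda>x. cis (2 * pi * (t * real i - t * real j) * x)) has_integral
        (if i = j then of_real (1/t) else 0)) {a..a + 1/t}"
    proof (cases "i = j")
      case True
      have "((\<lambda>x. 1::complex) has_integral of_real (1/t)) {a..a + 1/t}"
        using has_integral_const_real[of "1::complex" a "a + 1/t"] assms
        by (simp add: scaleR_conv_of_real)
      with True show ?thesis by simp
    next
      case False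
      let ?d = "t * real i - t * real j"
      have "?d \<noteq> 0" using False assms by simp
      \<comment> \<open>\<open>?d\<close> times the period \<open>1/t\<close> is an integer, so the
        antiderivative takes equal values at both ends.\<close>
      moreover have "cis (2 * pi * ?d * (a + 1/t)) = cis (2 * pi * of_int (int i - int j)) * cis (2 * pi * ?d * a)"
        unfolding cis_mult by (rule arg_cong[where f = cis]) (use assms in \<open>simp add: field_simps\<close>)
      ultimately show ?thesis
        using integral_cis[of ?d a "a + 1/t"] assms False by (simp only: cis_2pi_int) simp
    qed
    then show "(LINT x|lebesgue_on {a..a + 1/t}. cis (2 * pi * (t * real i - t * real j) * x))
        = (if i = j then of_real (1/t) else 0)"
      by (intro integral_lebesgue_on_cis) auto
  qed auto
qed

lemma cis_eq_cis_imp_shift: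
  assumes "cis (2 * pi * t * x) = cis (2 * pi * t * y)"
  obtains n :: int where "t * (x - y) = of_int n"
proof -
  have "cis (2 * pi * (t * (x - y))) = cis (2 * pi * t * x) / cis (2 * pi * t * y)"
    by (simp add: cis_divide algebra_simps)
  with assms have "cis (2 * pi * (t * (x - y))) = 1"
    by simp
  then have "cos (2 * pi * (t * (x - y))) = 1"
    by (metis cis.sel(1) one_complex.sel(1))
  then obtain n :: int where "2 * pi * (t * (x - y)) = of_int n * 2 * pi"
    using cos_one_2pi_int by blast
  then show thesis
    by (intro that[of n]) simp
qed

text \<open>Multipliers whose moduli tend to the indicator of the image of \<open>K\<close> on the
  circle are inserted into \<open>mult\<close>. In the limit the left side dominates the integral
  over \<open>K\<close>, and by orthogonality over one period the right side becomes
  \<open>t * B\<close> times the measure of \<open>K\<close>.\<close>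

lemma compact_integral_le:
  fixes g :: "real \<Rightarrow> real"
  assumes t: "t > 0" and g: "integrable (lebesgue_on S) g"
    and nonneg: "\<And>x. g x \<ge> 0"
    and mult: "\<And>p. (LINT x|lebesgue_on S. (cmod (poly p (cis (2 * pi * t * x))))\<^sup>2 * g x)
        \<le> B * (\<Sum>i\<le>degree p. (cmod (coeff p i))\<^sup>2)"
    and K: "compact K" "K \<subseteq> {a<..<a + 1/t}"
  shows "(LINT x|lebesgue_on S. indicator K x * g x) \<le> t * B * measure lebesgue K"
proof -
  let ?M = "lebesgue_on S" and ?J = "{a..a + 1/t}"
  let ?e = "\<lambda>x. cis (2 * pi * t * x)"
  let ?L = "?e ` K"
  note [measurable] = borel_measurable_integrable[OF g]
  have id[measurable]: "(\<lambda>x. x) \<in> borel_measurable (lebesgue_on A)" for A :: "real set"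
    using id_borel_measurable_lebesgue_on[of A] by (simp add: id_def)
  have cis[measurable]: "?e \<in> borel_measurable (lebesgue_on A)" for A :: "real set"
    unfolding cis_conv_exp by measurable
  have [measurable]: "(\<lambda>x. poly p (?e x)) \<in> borel_measurable (lebesgue_on A)" for p and A :: "real set"
    unfolding poly_altdef by measurable
  have L: "compact ?L"
    unfolding cis_conv_exp by (intro compact_continuous_image continuous_intros K)
  then have [measurable]: "?L \<in> sets borel"
    by (simp add: compact_imp_closed borel_closed)
  have Kb[measurable]: "K \<in> sets borel"
    using K by (simp add: compact_imp_closed borel_closed)
  have KS[measurable]: "indicator K \<in> borel_measurable (lebesgue_on A)" for A :: "real set"
    using measurable_compose[OF id, of "indicator K :: real \<Rightarrow> real" borel A] by simp
  obtain p where lim: "\<And>z. cmod z = 1 \<Longrightarrow> (\<lambda>n. cmod (poly (p n) z)) \<longlonglongrightarrow> indicator ?L z"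
    and bound: "\<And>n z. cmod z = 1 \<Longrightarrow> cmod (poly (p n) z) \<le> 2"
    by (rule poly_modulus_tendsto_indicator[OF L]) blast
  have sq_bound: "(cmod (poly (p n) (?e x)))\<^sup>2 \<le> 4" for n x
    using power_mono[OF bound[of "?e x" n], of 2] by simp
  have lim_sq: "(\<lambda>n. (cmod (poly (p n) (?e x)))\<^sup>2) \<longlonglongrightarrow> indicator ?L (?e x)" for x
  proof -
    have "(indicator ?L (?e x) :: real)\<^sup>2 = indicator ?L (?e x)"
      by (simp split: split_indicator)
    with tendsto_power[OF lim[of "?e x"], of 2] show ?thesis
      by (simp only: norm_cis)
  qed
  have lim1: "(\<lambda>n. LINT x|?M. (cmod (poly (p n) (?e x)))\<^sup>2 * g x)
      \<longlonglongrightarrow> (LINT x|?M. indicator ?L (?e x) * g x)"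
  proof (rule integral_dominated_convergence[where w = "\<lambda>x. 4 * g x"])
    show "integrable ?M (\<lambda>x. 4 * g x)" using g by simp
    show "AE x in ?M. (\<lambda>n. (cmod (poly (p n) (?e x)))\<^sup>2 * g x) \<longlonglongrightarrow> indicator ?L (?e x) * g x"
      by (intro AE_I2 tendsto_mult_right lim_sq)
    show "AE x in ?M. norm ((cmod (poly (p n) (?e x)))\<^sup>2 * g x) \<le> 4 * g x" for n
      using sq_bound nonneg by (auto simp: abs_mult intro!: mult_right_mono)
  qed measurable
  have lim2: "(\<lambda>n. LINT x|lebesgue_on ?J. (cmod (poly (p n) (?e x)))\<^sup>2)
      \<longlonglongrightarrow> (LINT x|lebesgue_on ?J. indicator ?L (?e x))"
  proof (rule integral_dominated_convergence[where w = "\<lambda>x. 4"])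
    show "integrable (lebesgue_on ?J) (\<lambda>x. 4 :: real)"
      by (intro finite_measure.integrable_const finite_measure_lebesgue_on) auto
    show "AE x in lebesgue_on ?J. (\<lambda>n. (cmod (poly (p n) (?e x)))\<^sup>2) \<longlonglongrightarrow> indicator ?L (?e x)"
      by (intro AE_I2 lim_sq)
    show "AE x in lebesgue_on ?J. norm ((cmod (poly (p n) (?e x)))\<^sup>2) \<le> 4" for n
      using sq_bound by auto
  qed measurable
  \<comment> \<open>\<open>K\<close> lies in the open period interval, so a point of
    \<open>?J\<close>, endpoints included, can share its image with a point of \<open>K\<close> only
    by being that point.\<close>
  have "(indicator ?L (?e x) :: real) = indicator K x" if x: "x \<in> ?J" for x
  proof -
    have "x \<in> K" if "?e x = ?e y" "y \<in> K" for y
    proof -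
      from that(1) obtain n :: int where n: "t * (x - y) = of_int n"
        by (rule cis_eq_cis_imp_shift)
      have "y \<in> {a<..<a + 1/t}" using that K by auto
      then have "\<bar>x - y\<bar> < 1/t" using x by auto
      then have "\<bar>t * (x - y)\<bar> < 1"
        unfolding abs_mult using t by (simp add: field_simps)
      then have "n = 0" unfolding n by linarith
      then show ?thesis using n t that by simp
    qed
    then show ?thesis by (auto simp: indicator_def)
  qed
  then have "(LINT x|lebesgue_on ?J. indicator ?L (?e x) :: real) = (LINT x|lebesgue_on ?J. indicator K x)"
    by (intro Bochner_Integration.integral_cong) auto
  also have "\<dots> = measure lebesgue K"
  proof -
    have "K \<subseteq> ?J" using K by auto
    moreover from this have "K \<inter> ?J = K" by auto
    moreover have "K \<in> sets lebesgue" using Kb by auto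
    ultimately show ?thesis
      by (simp add: measure_restrict_space Int_commute)
  qed
  finally have lim2': "(\<lambda>n. LINT x|lebesgue_on ?J. (cmod (poly (p n) (?e x)))\<^sup>2) \<longlonglongrightarrow> measure lebesgue K"
    using lim2 by simp
  \<comment> \<open>On \<open>S\<close> the indicator of the image sees all periodic copies of
    \<open>K\<close>; discarding the others can only decrease the integral because \<open>g\<close>
    is nonnegative.\<close>
  have "(LINT x|?M. indicator K x * g x) \<le> (LINT x|?M. indicator ?L (?e x) * g x)"
  proof (rule integral_mono)
    show "integrable ?M (\<lambda>x. indicator K x * g x)"
      by (rule Bochner_Integration.integrable_bound[OF g]) (auto simp: indicator_def)
    have [measurable]: "(\<lambda>x. indicator ?L (?e x) :: real) \<in> borel_measurable ?M"
      by (rule measurable_compose[OF cis]) measurable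
    show "integrable ?M (\<lambda>x. indicator ?L (?e x) * g x)"
      by (rule Bochner_Integration.integrable_bound[OF g]) (auto simp: indicator_def)
    show "indicator K x * g x \<le> indicator ?L (?e x) * g x" for x
      using nonneg[of x] by (auto simp: indicator_def)
  qed
  also have "\<dots> \<le> t * B * measure lebesgue K"
  proof (rule LIMSEQ_le[OF lim1 tendsto_mult_left[OF lim2']])
    have "(LINT x|?M. (cmod (poly (p n) (?e x)))\<^sup>2 * g x)
        \<le> t * B * (LINT x|lebesgue_on ?J. (cmod (poly (p n) (?e x)))\<^sup>2)" for n
      using mult[of "p n"] t by (simp add: integral_poly_cis_squared[OF t])
    then show "\<exists>n0. \<forall>n\<ge>n0. (LINT x|?M. (cmod (poly (p n) (?e x)))\<^sup>2 * g x)
        \<le> t * B * (LINT x|lebesgue_on ?J. (cmod (poly (p n) (?e x)))\<^sup>2)"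
      by blast
  qed
  finally show ?thesis .
qed

text \<open>A compact part of the set where \<open>g\<close> exceeds \<open>C\<close> must be null
  if it fits into an interval of length \<open>d\<close>. Inner regularity passes this on to the
  whole part inside such an interval, and countably many intervals cover the line up to grid
  points.\<close>

lemma AE_le_if_compact_integral_le:
  fixes g :: "real \<Rightarrow> real"
  assumes S: "S \<in> lmeasurable" and g: "integrable (lebesgue_on S) g" and "d > 0"
    and le: "\<And>a K. compact K \<Longrightarrow> K \<subseteq> {a<..<a + d} \<Longrightarrow> K \<subseteq> S \<Longrightarrow>
      (LINT x|lebesgue_on S. indicator K x * g x) \<le> C * measure lebesgue K"
  shows "AE x in lebesgue_on S. g x \<le> C"
proof -
  let ?M = "lebesgue_on S"
  interpret finite_measure ?M
    by (rule finite_measure_lebesgue_on[OF S])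
  have Ssets: "S \<in> sets lebesgue" using S by auto
  note [measurable] = borel_measurable_integrable[OF g]
  define Q where "Q = {x \<in> S. g x > C}"
  have "{x \<in> space ?M. g x > C} \<in> sets ?M" by measurable
  then have Q: "Q \<in> sets lebesgue"
    using Ssets by (simp add: Q_def sets_restrict_space_iff)
  have null_K: "K \<in> null_sets lebesgue" if K: "compact K" "K \<subseteq> {a<..<a + d}" "K \<subseteq> Q" for K a
  proof -
    have Ks: "K \<in> sets lebesgue" "K \<subseteq> S" "K \<in> lmeasurable"
      using K by (auto simp: Q_def lmeasurable_compact intro: fmeasurableD)
    then have [measurable]: "K \<in> sets ?M"
      using Ssets by (simp add: sets_restrict_space_iff)
    have intg: "integrable ?M (\<lambda>x. indicator K x * g x)"
      by (rule Bochner_Integration.integrable_bound[OF g]) (auto simp: indicator_def)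
    have intC: "integrable ?M (\<lambda>x. indicator K x * C)"
      by (rule integrable_const_bound[where B = "\<bar>C\<bar>"]) (auto simp: indicator_def)
    have eq: "(\<lambda>x. indicator K x * (g x - C)) = (\<lambda>x. indicator K x * g x - indicator K x * C)"
      by (simp add: fun_eq_iff right_diff_distrib)
    have int: "integrable ?M (\<lambda>x. indicator K x * (g x - C))"
      unfolding eq using intg intC by simp
    have meas: "(LINT x|?M. indicator K x * C) = C * measure lebesgue K"
      using Ks Ssets by (simp add: measure_restrict_space Int_absorb2)
    \<comment> \<open>The integrand is nonnegative and strictly positive on \<open>K\<close>, so a
      nonpositive integral forces \<open>K\<close> to be null.\<close>
    have "(LINT x|?M. indicator K x * (g x - C)) \<le> 0"
      unfolding eq Bochner_Integration.integral_diff[OF intg intC] meas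
      using le[OF K(1,2) Ks(2)] by linarith
    moreover have nn: "0 \<le> indicator K x * (g x - C)" for x
      using K(3) by (auto simp: indicator_def Q_def)
    ultimately have "(LINT x|?M. indicator K x * (g x - C)) = 0"
      by (intro antisym Bochner_Integration.integral_nonneg) auto
    then have "AE x in ?M. indicator K x * (g x - C) = 0"
      using integral_nonneg_eq_0_iff_AE[OF int] nn by simp
    then have "AE x in ?M. x \<notin> K"
      by eventually_elim (use K(3) in \<open>auto simp: indicator_def Q_def\<close>)
    then have "K \<in> null_sets ?M"
      by (subst AE_iff_null_sets) auto
    then show ?thesis
      using Ssets by (simp add: null_sets_restrict_space)
  qed
  have negl: "negligible (Q \<inter> {a<..<a + d})" for a
  proof (rule ccontr)
    let ?Q = "Q \<inter> {a<..<a + d}"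
    assume "\<not> negligible ?Q"
    moreover have Qs: "?Q \<in> sets lebesgue" using Q by auto
    ultimately have "emeasure lebesgue ?Q > 0"
      by (auto simp: negligible_iff_null_sets null_sets_def zero_less_iff_neq_zero)
    moreover have Qm: "?Q \<in> lmeasurable"
      using Qs by (intro bounded_set_imp_lmeasurable bounded_subset[OF bounded_box[of a "a + d"]])
        (auto simp: box_real)
    ultimately have pos: "measure lebesgue ?Q > 0"
      by (simp add: emeasure_eq_measure2)
    \<comment> \<open>The tolerance is the full measure of \<open>?Q\<close>, so
      \<open>small\<close> fails as soon as \<open>K\<close> is null.\<close>
    obtain K where K: "closed K" "K \<subseteq> ?Q" and small: "emeasure lebesgue (?Q - K) < ennreal (measure lebesgue ?Q)"
      using sets_lebesgue_inner_closed[OF Qs pos] by metis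
    have "bounded K"
      using K by (intro bounded_subset[OF bounded_box[of a "a + d"]]) (auto simp: box_real)
    then have "K \<in> null_sets lebesgue"
      using K by (intro null_K[of K a]) (auto simp: compact_eq_bounded_closed)
    then have "emeasure lebesgue (?Q - K) = emeasure lebesgue ?Q"
      using Qs by (rule emeasure_Diff_null_set)
    with small show False
      using Qm by (simp add: emeasure_eq_measure2)
  qed
  \<comment> \<open>The grid points are added separately because the intervals of length
    \<open>d\<close> are open.\<close>
  have "Q \<subseteq> (\<Union>n::int. Q \<inter> {of_int n * d<..<of_int n * d + d}) \<union> range (\<lambda>n::int. of_int n * d)"
  proof
    fix x assume x: "x \<in> Q"
    define n where "n = \<lfloor>x / d\<rfloor>"
    have "of_int n \<le> x / d" "x / d < of_int n + 1"
      unfolding n_def by linarith+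
    then have "of_int n * d \<le> x" "x < of_int n * d + d"
      using \<open>d > 0\<close> by (simp_all add: pos_le_divide_eq pos_divide_less_eq distrib_right)
    then show "x \<in> (\<Union>n::int. Q \<inter> {of_int n * d<..<of_int n * d + d}) \<union> range (\<lambda>n::int. of_int n * d)"
      using x by (cases "x = of_int n * d") force+
  qed
  moreover have "negligible ((\<Union>n::int. Q \<inter> {of_int n * d<..<of_int n * d + d}) \<union> range (\<lambda>n::int. of_int n * d))"
  proof (rule negligible_Un)
    show "negligible (\<Union>n::int. Q \<inter> {of_int n * d<..<of_int n * d + d})"
      by (rule negligible_countable_Union) (auto intro: negl)
    show "negligible (range (\<lambda>n::int. of_int n * d))"
      unfolding negligible_iff_null_sets
      by (intro null_sets_completionI countable_imp_null_set_lborel countable_image) auto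
  qed
  ultimately have "negligible Q"
    by (rule negligible_subset[rotated])
  then have "Q \<in> null_sets ?M"
    using Ssets by (simp add: negligible_iff_null_sets null_sets_restrict_space Q_def)
  then show ?thesis
    by (rule AE_I') (auto simp: Q_def)
qed

section \<open>Almost everywhere bound for the transforms of the modulated windows\<close>

theorem theorem3p5:
  fixes N M P r :: nat
    and W :: "nat \<Rightarrow> real \<Rightarrow> complex ^ 's"
    and B\<^sub>0 :: real
  assumes "N \<ge> 1" and "M \<ge> 1"
    and "odd r" and "coprime r N" and "1 \<le> r" and "r \<le> 2 * N - 1"
    and "\<forall>j\<in>T2 P. W j \<in> ell2 N r"
    and "dvnug_bessel N r M P W B\<^sub>0"
  shows "\<forall>m\<in>T1 M. \<forall>j\<in>T2 P. AE \<xi> in lebesgue_on (Omega N).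
           norm (fourier N r (Emod N r (real m / real M) (W j)) \<xi>) \<le> 2 * sqrt (real N * B\<^sub>0)"
proof (intro ballI)
  fix m j assume m: "m \<in> T1 M" and j: "j \<in> T2 P"
  \<comment> \<open>Since \<open>8 * pi * N = 2 * pi * ?t\<close>, the multipliers have period
    \<open>1 / ?t\<close>; the resulting bound \<open>?t * B\<^sub>0\<close> on the squared norm has
    root \<open>2 * sqrt (N * B\<^sub>0)\<close>.\<close>
  let ?t = "4 * real N"
  define f where "f = fourier N r (Emod N r (real m / real M) (W j))"
  have W: "W j \<in> ell2 N r" using assms j by blast
  have f: "is_fourier N r (Emod N r (real m / real M) (W j)) f"
    unfolding f_def by (intro is_fourier_fourier assms ell2_Emod W)
  then have int: "integrable (lebesgue_on (Omega N)) (\<lambda>\<xi>. (norm (f \<xi>))\<^sup>2)"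
    by (simp add: is_fourier_def L2_Omega_def)
  have t: "?t > 0" using \<open>N \<ge> 1\<close> by simp
  have "AE \<xi> in lebesgue_on (Omega N). (norm (f \<xi>))\<^sup>2 \<le> ?t * B\<^sub>0"
  proof (rule AE_le_if_compact_integral_le[OF Omega_lmeasurable int, of "1 / ?t"])
    fix a K assume K: "compact K" "K \<subseteq> {a<..<a + 1 / ?t}"
    show "(LINT \<xi>|lebesgue_on (Omega N). indicator K \<xi> * (norm (f \<xi>))\<^sup>2) \<le> ?t * B\<^sub>0 * measure lebesgue K"
    proof (rule compact_integral_le[OF t int _ _ K])
      fix p
      show "(LINT \<xi>|lebesgue_on (Omega N). (cmod (poly p (cis (2 * pi * ?t * \<xi>))))\<^sup>2 * (norm (f \<xi>))\<^sup>2)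
          \<le> B\<^sub>0 * (\<Sum>i\<le>degree p. (cmod (coeff p i))\<^sup>2)"
        using polynomial_multiplier_le[OF assms(1,3,8) m j W f, of p] by (simp add: mult_ac)
    qed simp
  qed (use t in simp)
  then show "AE \<xi> in lebesgue_on (Omega N). norm (fourier N r (Emod N r (real m / real M) (W j)) \<xi>)
      \<le> 2 * sqrt (real N * B\<^sub>0)"
    unfolding f_def[symmetric]
  proof eventually_elim
    fix \<xi> assume "(norm (f \<xi>))\<^sup>2 \<le> ?t * B\<^sub>0"
    then have "norm (f \<xi>) \<le> sqrt (4 * (real N * B\<^sub>0))"
      by (intro real_le_rsqrt) (simp add: mult_ac)
    then show "norm (f \<xi>) \<le> 2 * sqrt (real N * B\<^sub>0)"
      by (simp add: real_sqrt_mult)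
  qed
qed

end
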